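(* For each integer $N>0$ and each $m\geq 2$, there are a sequence $\{(O^\ell,h^\ell)\}_{\ell\in\mathbb{N}}$ of $2m$-dimensional closed oriented Riemannian orbifolds with singular points and a closed oriented Riemannian manifold $(M,g)$ such that as $\ell\to\infty$, the Laplace spectra of $(O^\ell,h^\ell)$ converge to that of $(M,g)$ in the sense that for all $k=0,1,\dots,N$, $$\vert\lambda_k(O^\ell,h^\ell)-\lambda_k(M,g)\vert<1/\ell.$$
   Context: Orbifolds are smooth; "with singular points" means that the set of singular points (points with nontrivial isotropy) is nonempty. $\lambda_k(O,g)$ denotes the $k$th eigenvalue of the Laplacian acting on functions on $(O,g)$: nonzero eigenvalues are listed in nondecreasing order with multiplicity with indices $k=1,2,\dots$, and the eigenvalue $0$ has index $0$. *)

theory Defs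
  imports "HOL-Analysis.Analysis" "HOL-Algebra.Bij" "HOL-Library.Function_Algebras"
begin

section \<open>Smooth maps on open sets\<close>

primrec Ck_on :: "nat \<Rightarrow> 'a::real_normed_vector set \<Rightarrow> ('a \<Rightarrow> 'b::real_normed_vector) \<Rightarrow> bool" where
  "Ck_on 0 U f \<longleftrightarrow> continuous_on U f"
| "Ck_on (Suc k) U f \<longleftrightarrow>
     (\<forall>x\<in>U. f differentiable (at x)) \<and>
     (\<forall>v. Ck_on k U (\<lambda>x. frechet_derivative f (at x) v))"

definition smooth_on :: "'a::real_normed_vector set \<Rightarrow> ('a \<Rightarrow> 'b::real_normed_vector) \<Rightarrow> bool" where
  "smooth_on U f \<longleftrightarrow> (\<forall>k. Ck_on k U f)"

definition diffeomorphism ::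
  "'a::real_normed_vector set \<Rightarrow> 'b::real_normed_vector set \<Rightarrow> ('a \<Rightarrow> 'b) \<Rightarrow> bool" where
  "diffeomorphism U V h \<longleftrightarrow>
     open U \<and> open V \<and> bij_betw h U V \<and> smooth_on U h \<and> smooth_on V (inv_into U h)"

definition jacobian :: "(real^'n \<Rightarrow> real^'n) \<Rightarrow> real^'n \<Rightarrow> real^'n^'n" where
  "jacobian h x = matrix (frechet_derivative h (at x))"

definition partial :: "'n \<Rightarrow> (real^'n \<Rightarrow> real) \<Rightarrow> real^'n \<Rightarrow> real" where
  "partial i u x = frechet_derivative u (at x) (axis i 1)"


section \<open>Orbifolds\<close>

record ('a, 'n::finite) orbifold_chart =
  chart_dom :: "(real^'n) set"
  chart_group :: "(real^'n \<Rightarrow> real^'n) set"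
  chart_map :: "real^'n \<Rightarrow> 'a"
  chart_metric :: "real^'n \<Rightarrow> real^'n^'n"

record ('a, 'n::finite) riem_orbifold =
  orb_space :: "'a topology"
  orb_atlas :: "('a, 'n) orbifold_chart set"

text \<open>
  The local group is a set of transformations of the chart domain, so it acts effectively.
  The chart map induces a homeomorphism from the orbit space of the chart domain onto an
  open subset of \<open>X\<close>.
\<close>

definition is_orbifold_chart :: "'a topology \<Rightarrow> ('a, 'n::finite) orbifold_chart \<Rightarrow> bool" where
  "is_orbifold_chart X c \<longleftrightarrow>
     open (chart_dom c) \<and> connected (chart_dom c) \<and> chart_dom c \<noteq> {} \<and>
     finite (chart_group c) \<and> subgroup (chart_group c) (BijGroup (chart_dom c)) \<and>
     (\<forall>\<gamma>\<in>chart_group c. smooth_on (chart_dom c) \<gamma>) \<and>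
     openin X (chart_map c ` chart_dom c) \<and>
     quotient_map (top_of_set (chart_dom c)) (subtopology X (chart_map c ` chart_dom c))
       (chart_map c) \<and>
     (\<forall>x\<in>chart_dom c. \<forall>y\<in>chart_dom c.
        chart_map c x = chart_map c y \<longleftrightarrow> (\<exists>\<gamma>\<in>chart_group c. \<gamma> x = y))"

text \<open>
  Changes of charts: diffeomorphisms between open subsets of chart domains that cover the
  identity of the underlying space. Elements of a local group are included (take \<open>c = d\<close>).
\<close>

definition chart_transition ::
  "('a, 'n::finite) orbifold_chart \<Rightarrow> ('a, 'n) orbifold_chart \<Rightarrow>
     (real^'n) set \<Rightarrow> (real^'n \<Rightarrow> real^'n) \<Rightarrow> bool" where
  "chart_transition c d W h \<longleftrightarrow>
     W \<subseteq> chart_dom c \<and> h ` W \<subseteq> chart_dom d \<and> diffeomorphism W (h ` W) h \<and>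
     (\<forall>x\<in>W. chart_map d (h x) = chart_map c x)"

definition is_orbifold :: "('a, 'n::finite) riem_orbifold \<Rightarrow> bool" where
  "is_orbifold P \<longleftrightarrow>
     Hausdorff_space (orb_space P) \<and> second_countable (orb_space P) \<and>
     topspace (orb_space P) \<noteq> {} \<and>
     (\<forall>c\<in>orb_atlas P. is_orbifold_chart (orb_space P) c) \<and>
     (\<Union>c\<in>orb_atlas P. chart_map c ` chart_dom c) = topspace (orb_space P) \<and>
     (\<forall>c\<in>orb_atlas P. \<forall>d\<in>orb_atlas P. \<forall>x\<in>chart_dom c. \<forall>y\<in>chart_dom d.
        chart_map c x = chart_map d y \<longrightarrow>
        (\<exists>W h. chart_transition c d W h \<and> x \<in> W \<and> h x = y))"

text \<open>
  A Riemannian metric is a smooth field of positive definite symmetric matrices on every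
  chart domain for which all changes of charts, in particular the elements of the local
  groups, are isometries.
\<close>

definition is_riemannian_orbifold :: "('a, 'n::finite) riem_orbifold \<Rightarrow> bool" where
  "is_riemannian_orbifold P \<longleftrightarrow>
     is_orbifold P \<and>
     (\<forall>c\<in>orb_atlas P. smooth_on (chart_dom c) (chart_metric c) \<and>
        (\<forall>x\<in>chart_dom c. transpose (chart_metric c x) = chart_metric c x \<and>
           (\<forall>v. v \<noteq> 0 \<longrightarrow> v \<bullet> (chart_metric c x *v v) > 0))) \<and>
     (\<forall>c\<in>orb_atlas P. \<forall>d\<in>orb_atlas P. \<forall>W h. chart_transition c d W h \<longrightarrow>
        (\<forall>x\<in>W. transpose (jacobian h x) ** chart_metric d (h x) ** jacobian h x
                = chart_metric c x))"

text \<open>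
  An orientation is given by an oriented atlas: all changes of charts, in particular the
  elements of the local groups, preserve the standard orientation.
\<close>

definition is_oriented :: "('a, 'n::finite) riem_orbifold \<Rightarrow> bool" where
  "is_oriented P \<longleftrightarrow>
     (\<forall>c\<in>orb_atlas P. \<forall>d\<in>orb_atlas P. \<forall>W h. chart_transition c d W h \<longrightarrow>
        (\<forall>x\<in>W. det (jacobian h x) > 0))"

text \<open>
  Closed means compact without boundary. Orbifolds have no boundary by definition, and
  closed orbifolds are connected by convention: the eigenvalue \<open>0\<close> of the Laplacian has
  multiplicity one.
\<close>

definition closed_oriented_riemannian_orbifold :: "('a, 'n::finite) riem_orbifold \<Rightarrow> bool" where
  "closed_oriented_riemannian_orbifold P \<longleftrightarrow>
     is_riemannian_orbifold P \<and> is_oriented P \<and>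
     compact_space (orb_space P) \<and> connected_space (orb_space P)"

text \<open>
  With trivial local groups the chart maps are homeomorphisms onto open sets, and the
  changes of charts say that the atlas is a smooth manifold atlas.
\<close>

definition closed_oriented_riemannian_manifold :: "('a, 'n::finite) riem_orbifold \<Rightarrow> bool" where
  "closed_oriented_riemannian_manifold P \<longleftrightarrow>
     closed_oriented_riemannian_orbifold P \<and>
     (\<forall>c\<in>orb_atlas P. chart_group c = {\<lambda>x\<in>chart_dom c. x})"

definition singular_points :: "('a, 'n::finite) riem_orbifold \<Rightarrow> 'a set" where
  "singular_points P =
     {p. \<exists>c\<in>orb_atlas P. \<exists>x\<in>chart_dom c. chart_map c x = p \<and>
           (\<exists>\<gamma>\<in>chart_group c. \<gamma> \<noteq> (\<lambda>z\<in>chart_dom c. z) \<and> \<gamma> x = x)}"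


section \<open>The Laplace spectrum\<close>

text \<open>
  The nonnegative Laplacian on functions in local coordinates,
  \<open>- 1 / \<surd>(det g) \<Sum>\<^sub>i \<partial>\<^sub>i (\<surd>(det g) \<Sum>\<^sub>j g\<^sup>i\<^sup>j \<partial>\<^sub>j u)\<close>.
\<close>

definition laplacian ::
  "(real^'n \<Rightarrow> real^'n^'n) \<Rightarrow> (real^'n \<Rightarrow> real) \<Rightarrow> real^'n \<Rightarrow> real" where
  "laplacian g u x =
     - (\<Sum>i\<in>UNIV. partial i
          (\<lambda>y. sqrt (det (g y)) * (\<Sum>j\<in>UNIV. matrix_inv (g y) $ i $ j * partial j u y)) x)
       / sqrt (det (g x))"

text \<open>
  A function on an orbifold is smooth if its lifts to all chart domains are smooth. Functions
  are extended by zero outside the underlying space.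
\<close>

definition laplace_eigenspace ::
  "('a, 'n::finite) riem_orbifold \<Rightarrow> real \<Rightarrow> ('a \<Rightarrow> real) set" where
  "laplace_eigenspace P \<mu> =
     {f. (\<forall>p. p \<notin> topspace (orb_space P) \<longrightarrow> f p = 0) \<and>
         (\<forall>c\<in>orb_atlas P. smooth_on (chart_dom c) (f \<circ> chart_map c) \<and>
            (\<forall>x\<in>chart_dom c.
               laplacian (chart_metric c) (f \<circ> chart_map c) x = \<mu> * f (chart_map c x)))}"

interpretation function_space: vector_space "\<lambda>(r::real) (f::'a \<Rightarrow> real) p. r * f p"
  by unfold_locales (simp_all add: fun_eq_iff algebra_simps)

definition lists_laplace_spectrum ::
  "('a, 'n::finite) riem_orbifold \<Rightarrow> (nat \<Rightarrow> real) \<Rightarrow> bool" where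
  "lists_laplace_spectrum P lam \<longleftrightarrow>
     lam 0 = 0 \<and> (\<forall>k\<ge>1. lam k \<noteq> 0) \<and> mono_on {1..} lam \<and>
     (\<forall>\<mu>. \<mu> \<noteq> 0 \<longrightarrow>
        finite {k. 1 \<le> k \<and> lam k = \<mu>} \<and>
        card {k. 1 \<le> k \<and> lam k = \<mu>} = function_space.dim (laplace_eigenspace P \<mu>))"

lemma lists_laplace_spectrum_unique_aux:
  assumes "lists_laplace_spectrum P a" and "lists_laplace_spectrum P b"
    and "\<And>j. j < k \<Longrightarrow> a j = b j"
  shows "\<not> a k < b k"
proof
  assume less: "a k < b k"
  have k: "k \<ge> 1"
    using assms(1,2) less by (cases k) (auto simp: lists_laplace_spectrum_def)
  let ?A = "{j. 1 \<le> j \<and> a j = a k}" and ?B = "{j. 1 \<le> j \<and> b j = a k}"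
  have nz: "a k \<noteq> 0" using assms(1) k by (auto simp: lists_laplace_spectrum_def)
  have fin: "finite ?A" and card: "card ?A = card ?B"
    using assms(1,2) nz by (auto simp: lists_laplace_spectrum_def)
  have "j < k" if "j \<in> ?B" for j
  proof (rule ccontr)
    assume "\<not> j < k"
    then have "b k \<le> b j"
      using assms(2) k by (auto simp: lists_laplace_spectrum_def intro: mono_onD)
    then show False using that less by simp
  qed
  then have "?B \<subseteq> ?A - {k}" using assms(3) by fastforce
  then have "card ?B \<le> card (?A - {k})" using fin by (intro card_mono) auto
  also have "\<dots> < card ?A" using fin k by (intro card_Diff1_less) auto
  finally show False using card by simp
qed

lemma lists_laplace_spectrum_unique:
  assumes "lists_laplace_spectrum P a" and "lists_laplace_spectrum P b"
  shows "a = b"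
proof
  show "a k = b k" for k
  proof (induction k rule: less_induct)
    case (less k)
    then show ?case
      using lists_laplace_spectrum_unique_aux[OF assms, of k]
        lists_laplace_spectrum_unique_aux[OF assms(2,1), of k] by force
  qed
qed

text \<open>
  By the spectral theorem, a sequence listing the spectrum exists for every closed connected
  Riemannian orbifold of positive dimension.
\<close>

definition laplace_eigenvalue :: "('a, 'n::finite) riem_orbifold \<Rightarrow> nat \<Rightarrow> real" where
  "laplace_eigenvalue P = (THE lam. lists_laplace_spectrum P lam)"

end

theory Submission
  imports Defs
begin

text \<open>
  In directions in which a flat space is short, only large eigenvalues of the Laplacian arise. The low
  part of the spectrum of a thin space therefore does not reveal whether an isometry that only acts in
  the short directions has been divided out, even if this isometry has fixed points.
  
  In detail, let \<open>M\<close> be the flat torus with side \<open>2\<pi>\<close> in one coordinate direction \<open>c\<close> and side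
  \<open>2\<pi> / (N + 1)\<close> in the others. Its eigenfunctions are combinations of the functions
  \<open>cos (\<xi> \<bullet> x)\<close> and \<open>sin (\<xi> \<bullet> x)\<close> with \<open>\<xi>\<close> in the dual lattice, with eigenvalue \<open>\<xi> \<bullet> \<xi>\<close>. If
  \<open>\<xi> \<bullet> \<xi> < (N + 1)\<^sup>2\<close>, then \<open>\<xi>\<close> is an integer multiple of the unit vector in direction \<open>c\<close>, and the
  eigenfunction depends on \<open>x\<^sub>c\<close> only. Let \<open>P\<close> be the quotient of \<open>M\<close> by the half-turn that changes the
  signs of two other coordinates \<open>a\<close> and \<open>b\<close>. It is an oriented orbifold with a singular point at the
  image of the origin. Its eigenfunctions are the eigenfunctions of \<open>M\<close> that are invariant under the
  half-turn, and below \<open>(N + 1)\<^sup>2\<close> this is all of them. As \<open>1, 4, \<dots>, N\<^sup>2\<close> are eigenvalues, the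
  eigenvalues with index at most \<open>N\<close> lie below \<open>(N + 1)\<^sup>2\<close>. They are equal for \<open>P\<close> and \<open>M\<close>, and the
  constant sequence \<open>P\<close> has the required property.
  
  Three facts carry this argument. The quotient of \<open>\<real>\<^sup>n\<close> by a discrete cocompact group of
  orientation-preserving motions is a closed oriented Riemannian orbifold
  (\<open>closed_oriented_riemannian_orbifold_quotient_orbifold\<close>), whose eigenspaces are the spaces of
  invariant eigenfunctions on \<open>\<real>\<^sup>n\<close> (\<open>dim_laplace_eigenspace\<close>). A periodic eigenfunction is a
  combination of trigonometric functions of the same eigenvalue (\<open>eigenfunction_in_span_trig\<close>), by the
  completeness of the trigonometric system. The list of eigenvalues below a bound is determined by the
  eigenspaces below that bound (\<open>laplace_eigenvalue_cong_below\<close>).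
\<close>

section \<open>Smooth functions and the flat Laplacian\<close>

lemma Ck_on_cong:
  assumes "open U" and "\<And>x. x \<in> U \<Longrightarrow> f x = g x" and "Ck_on k U f"
  shows "Ck_on k U g"
  using assms(2,3)
proof (induction k arbitrary: f g)
  case 0
  then show ?case by (simp cong: continuous_on_cong)
next
  case (Suc k)
  have diff: "g differentiable at x" if "x \<in> U" for x
  proof -
    have "f differentiable at x" using Suc.prems(2) that by simp
    then obtain f' where "(f has_derivative f') (at x)" unfolding differentiable_def by blast
    then have "(g has_derivative f') (at x)"
      by (rule has_derivative_transform_within_open[OF _ \<open>open U\<close> that Suc.prems(1)])
    then show ?thesis unfolding differentiable_def by blast
  qed
  have eq: "frechet_derivative f (at x) = frechet_derivative g (at x)" if "x \<in> U" for x
    using Suc.prems(2) by (intro frechet_derivative_transform_within_open[OF _ \<open>open U\<close> that Suc.prems(1)]) (use that in auto)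
  have "Ck_on k U (\<lambda>x. frechet_derivative g (at x) v)" for v
  proof (rule Suc.IH)
    show "Ck_on k U (\<lambda>x. frechet_derivative f (at x) v)" using Suc.prems(2) by simp
  qed (simp add: eq)
  with diff show ?case by simp
qed

lemma smooth_on_cong:
  assumes "open U" and "\<And>x. x \<in> U \<Longrightarrow> f x = g x" and "smooth_on U f"
  shows "smooth_on U g"
  using Ck_on_cong[OF assms(1,2)] assms(3) by (auto simp: smooth_on_def)

lemma Ck_on_subset: "Ck_on k U f \<Longrightarrow> V \<subseteq> U \<Longrightarrow> Ck_on k V f"
  by (induction k arbitrary: f) (auto intro: continuous_on_subset)

lemma smooth_on_subset: "smooth_on U f \<Longrightarrow> V \<subseteq> U \<Longrightarrow> smooth_on V f"
  by (auto simp: smooth_on_def intro: Ck_on_subset)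

text \<open>
  Smoothness is a local property. This is what turns the smoothness of all lifts to small chart
  domains, which is how functions on an orbifold are declared smooth, into smoothness of one lift to
  the whole of \<open>\<real>\<^sup>n\<close>.
\<close>

lemma Ck_on_UN:
  "(\<And>i. i \<in> I \<Longrightarrow> open (U i)) \<Longrightarrow> (\<And>i. i \<in> I \<Longrightarrow> Ck_on k (U i) f) \<Longrightarrow> Ck_on k (\<Union>i\<in>I. U i) f"
  by (induction k arbitrary: f) (auto intro: continuous_on_open_UN)

lemma smooth_on_UN:
  "(\<And>i. i \<in> I \<Longrightarrow> open (U i)) \<Longrightarrow> (\<And>i. i \<in> I \<Longrightarrow> smooth_on (U i) f) \<Longrightarrow> smooth_on (\<Union>i\<in>I. U i) f"
  by (auto simp: smooth_on_def intro: Ck_on_UN)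

lemma Ck_on_const: "Ck_on k U (\<lambda>x. c)"
  by (induction k arbitrary: c) auto

lemma smooth_on_const: "smooth_on U (\<lambda>x. c)"
  by (simp add: smooth_on_def Ck_on_const)

lemma has_derivative_affine:
  fixes A :: "real^'n^'m"
  shows "((\<lambda>x. A *v x + b) has_derivative (\<lambda>v. A *v v)) (at x)"
  by (auto intro!: derivative_eq_intros bounded_linear_imp_has_derivative matrix_vector_mul_bounded_linear)

lemma smooth_on_affine:
  fixes A :: "real^'n^'m"
  shows "smooth_on U (\<lambda>x. A *v x + b)"
  unfolding smooth_on_def
proof
  fix k show "Ck_on k U (\<lambda>x. A *v x + b)"
  proof (cases k)
    case 0
    then show ?thesis
      by (auto intro!: continuous_at_imp_continuous_on has_derivative_continuous[OF has_derivative_affine])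
  next
    case (Suc k)
    have "frechet_derivative (\<lambda>x. A *v x + b) (at x) = (\<lambda>v. A *v v)" for x
      using frechet_derivative_at[OF has_derivative_affine] by metis
    moreover have "(\<lambda>x. A *v x + b) differentiable at x" for x
      using has_derivative_affine differentiable_def by blast
    ultimately show ?thesis by (simp add: Suc Ck_on_const)
  qed
qed

lemma has_derivative_trig:
  fixes \<xi> x :: "'a::real_inner"
  shows "((\<lambda>x. c * cos (\<xi> \<bullet> x)) has_derivative (\<lambda>v. - (c * (\<xi> \<bullet> v)) * sin (\<xi> \<bullet> x))) (at x)"
    and "((\<lambda>x. c * sin (\<xi> \<bullet> x)) has_derivative (\<lambda>v. c * (\<xi> \<bullet> v) * cos (\<xi> \<bullet> x))) (at x)"
  by (auto intro!: derivative_eq_intros)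

lemma frechet_derivative_trig:
  fixes \<xi> x :: "'a::real_inner"
  shows "frechet_derivative (\<lambda>x. c * cos (\<xi> \<bullet> x)) (at x) = (\<lambda>v. - (c * (\<xi> \<bullet> v)) * sin (\<xi> \<bullet> x))"
    and "frechet_derivative (\<lambda>x. c * sin (\<xi> \<bullet> x)) (at x) = (\<lambda>v. c * (\<xi> \<bullet> v) * cos (\<xi> \<bullet> x))"
  using frechet_derivative_at[OF has_derivative_trig(1)] frechet_derivative_at[OF has_derivative_trig(2)]
  by metis+

text \<open>
  The derivatives of \<open>c cos (\<xi> \<bullet> x)\<close> and \<open>c sin (\<xi> \<bullet> x)\<close> in a fixed direction are functions of the
  other kind with another factor \<open>c\<close>. The induction therefore treats both at once, for all \<open>c\<close>.
\<close>

lemma smooth_on_trig: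
  fixes \<xi> :: "'a::real_inner"
  shows "smooth_on U (\<lambda>x. c * cos (\<xi> \<bullet> x))" and "smooth_on U (\<lambda>x. c * sin (\<xi> \<bullet> x))"
proof -
  have "Ck_on k U (\<lambda>x. c * cos (\<xi> \<bullet> x)) \<and> Ck_on k U (\<lambda>x. c * sin (\<xi> \<bullet> x))" for k c
  proof (induction k arbitrary: c)
    case 0
    show ?case by (auto intro!: continuous_intros)
  next
    case (Suc k)
    have "(\<lambda>x. c * cos (\<xi> \<bullet> x)) differentiable at x" "(\<lambda>x. c * sin (\<xi> \<bullet> x)) differentiable at x" for x
      using has_derivative_trig differentiable_def by blast+
    then show ?case using Suc by (simp only: Ck_on.simps frechet_derivative_trig) simp
  qed
  then show "smooth_on U (\<lambda>x. c * cos (\<xi> \<bullet> x))" "smooth_on U (\<lambda>x. c * sin (\<xi> \<bullet> x))"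
    by (simp_all add: smooth_on_def)
qed

lemma smooth_on_differentiable: "smooth_on U f \<Longrightarrow> x \<in> U \<Longrightarrow> f differentiable at x"
  unfolding smooth_on_def using Ck_on.simps(2) by blast

lemma smooth_on_imp_continuous_on: "smooth_on U f \<Longrightarrow> continuous_on U f"
  unfolding smooth_on_def using Ck_on.simps(1) by blast

lemma smooth_on_partial: "smooth_on U f \<Longrightarrow> smooth_on U (partial i f)"
  unfolding smooth_on_def partial_def[abs_def] using Ck_on.simps(2) by blast

text \<open>
  The Laplacian of the Euclidean metric; it is nonnegative as an operator.
\<close>

definition flat_laplacian :: "(real^'n \<Rightarrow> real) \<Rightarrow> real^'n \<Rightarrow> real" where
  "flat_laplacian u x = - (\<Sum>i\<in>UNIV. partial i (partial i u) x)"

lemma laplacian_mat_1: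
  fixes u :: "real^'n \<Rightarrow> real"
  shows "laplacian (\<lambda>_. mat 1) u = flat_laplacian u"
proof -
  have inv: "matrix_inv (mat 1 :: real^'n^'n) = mat 1"
    by (simp add: matrix_inv_def)
  have "(\<Sum>j\<in>UNIV. (mat 1 :: real^'n^'n) $ i $ j * partial j u y) = partial i u y" for i y
    by (simp add: mat_def if_distrib[of "\<lambda>x. x * _"] cong: if_cong)
  then show ?thesis
    by (simp add: laplacian_def flat_laplacian_def inv fun_eq_iff cong: if_cong)
qed

lemma flat_laplacian_trig:
  fixes \<xi> :: "real^'n"
  shows "flat_laplacian (\<lambda>x. cos (\<xi> \<bullet> x)) x = (\<xi> \<bullet> \<xi>) * cos (\<xi> \<bullet> x)"
    and "flat_laplacian (\<lambda>x. sin (\<xi> \<bullet> x)) x = (\<xi> \<bullet> \<xi>) * sin (\<xi> \<bullet> x)"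
proof -
  have c: "partial i (\<lambda>x. c * cos (\<xi> \<bullet> x)) = (\<lambda>x. (- c * \<xi> $ i) * sin (\<xi> \<bullet> x))" for c i
    by (auto simp: partial_def[abs_def] frechet_derivative_trig inner_axis)
  have s: "partial i (\<lambda>x. c * sin (\<xi> \<bullet> x)) = (\<lambda>x. (c * \<xi> $ i) * cos (\<xi> \<bullet> x))" for c i
    by (auto simp: partial_def[abs_def] frechet_derivative_trig inner_axis)
  have "partial i (partial i (\<lambda>x. cos (\<xi> \<bullet> x))) x = - (\<xi> $ i * \<xi> $ i) * cos (\<xi> \<bullet> x)"
    "partial i (partial i (\<lambda>x. sin (\<xi> \<bullet> x))) x = - (\<xi> $ i * \<xi> $ i) * sin (\<xi> \<bullet> x)" for i
    using c[of i 1] s[of i 1] c[of i "\<xi> $ i"] s[of i "- \<xi> $ i"] by simp_all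
  then show "flat_laplacian (\<lambda>x. cos (\<xi> \<bullet> x)) x = (\<xi> \<bullet> \<xi>) * cos (\<xi> \<bullet> x)"
    "flat_laplacian (\<lambda>x. sin (\<xi> \<bullet> x)) x = (\<xi> \<bullet> \<xi>) * sin (\<xi> \<bullet> x)"
    by (simp_all add: flat_laplacian_def inner_vec_def sum_distrib_right sum_negf)
qed

section \<open>Quotients of Euclidean space by groups of motions\<close>

definition orbit :: "('a \<Rightarrow> 'a) set \<Rightarrow> 'a \<Rightarrow> 'a set" where
  "orbit \<Gamma> x = (\<lambda>\<gamma>. \<gamma> x) ` \<Gamma>"

definition orbit_topology :: "('a::topological_space \<Rightarrow> 'a) set \<Rightarrow> 'a set topology" where
  "orbit_topology \<Gamma> = topology (\<lambda>U. U \<subseteq> range (orbit \<Gamma>) \<and> open (orbit \<Gamma> -` U))"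

text \<open>
  The factor \<open>2\<close> separates the ball of this radius around \<open>p\<close> from its images under all isometries in
  \<open>\<Gamma>\<close> that move \<open>p\<close>. Points of the ball on one orbit are then related by the isotropy group of \<open>p\<close>,
  which makes the ball the domain of an orbifold chart.
\<close>

definition isotropy_radius :: "('a::metric_space \<Rightarrow> 'a) set \<Rightarrow> 'a \<Rightarrow> real" where
  "isotropy_radius \<Gamma> p = (SOME r. r > 0 \<and> (\<forall>\<gamma>\<in>\<Gamma>. \<gamma> p \<noteq> p \<longrightarrow> 2 * r \<le> dist (\<gamma> p) p))"

abbreviation isotropy_ball :: "('a::metric_space \<Rightarrow> 'a) set \<Rightarrow> 'a \<Rightarrow> 'a set" where
  "isotropy_ball \<Gamma> p \<equiv> ball p (isotropy_radius \<Gamma> p)"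

definition quotient_chart ::
  "(real^'n::finite \<Rightarrow> real^'n) set \<Rightarrow> real^'n \<Rightarrow> ((real^'n) set, 'n) orbifold_chart" where
  "quotient_chart \<Gamma> p =
    \<lparr>chart_dom = isotropy_ball \<Gamma> p,
     chart_group = (\<lambda>\<gamma>. restrict \<gamma> (isotropy_ball \<Gamma> p)) ` {\<gamma> \<in> \<Gamma>. \<gamma> p = p},
     chart_map = orbit \<Gamma>,
     chart_metric = (\<lambda>_. mat 1)\<rparr>"

definition quotient_orbifold ::
  "(real^'n::finite \<Rightarrow> real^'n) set \<Rightarrow> ((real^'n) set, 'n) riem_orbifold" where
  "quotient_orbifold \<Gamma> = \<lparr>orb_space = orbit_topology \<Gamma>, orb_atlas = range (quotient_chart \<Gamma>)\<rparr>"

lemma quotient_chart_simps [simp]: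
  "chart_dom (quotient_chart \<Gamma> p) = isotropy_ball \<Gamma> p"
  "chart_group (quotient_chart \<Gamma> p) = (\<lambda>\<gamma>. restrict \<gamma> (isotropy_ball \<Gamma> p)) ` {\<gamma> \<in> \<Gamma>. \<gamma> p = p}"
  "chart_map (quotient_chart \<Gamma> p) = orbit \<Gamma>"
  "chart_metric (quotient_chart \<Gamma> p) = (\<lambda>_. mat 1)"
  by (simp_all add: quotient_chart_def)

lemma quotient_orbifold_simps [simp]:
  "orb_space (quotient_orbifold \<Gamma>) = orbit_topology \<Gamma>"
  "orb_atlas (quotient_orbifold \<Gamma>) = range (quotient_chart \<Gamma>)"
  by (simp_all add: quotient_orbifold_def)

lemma openin_orbit_topology:
  "openin (orbit_topology \<Gamma>) U \<longleftrightarrow> U \<subseteq> range (orbit \<Gamma>) \<and> open (orbit \<Gamma> -` U)"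
proof -
  have "istopology (\<lambda>U. U \<subseteq> range (orbit \<Gamma>) \<and> open (orbit \<Gamma> -` U))"
    unfolding istopology_def by (auto simp: vimage_Union vimage_Int)
  then show ?thesis by (simp add: orbit_topology_def)
qed

lemma topspace_orbit_topology [simp]: "topspace (orbit_topology \<Gamma>) = range (orbit \<Gamma>)"
proof
  show "topspace (orbit_topology \<Gamma>) \<subseteq> range (orbit \<Gamma>)"
    by (metis openin_topspace openin_orbit_topology)
  have "orbit \<Gamma> -` range (orbit \<Gamma>) = UNIV" by auto
  then have "openin (orbit_topology \<Gamma>) (range (orbit \<Gamma>))" by (simp add: openin_orbit_topology)
  then show "range (orbit \<Gamma>) \<subseteq> topspace (orbit_topology \<Gamma>)" by (rule openin_subset)
qed

lemma rotation_matrix_dist: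
  fixes A :: "real^'n^'n"
  assumes "rotation_matrix A"
  shows "dist (A *v x + b) (A *v y + b) = dist x y"
proof -
  have "orthogonal_transformation (\<lambda>x. A *v x)"
    using assms by (simp add: orthogonal_transformation_matrix rotation_matrix_def)
  then have "norm (A *v (x - y)) = norm (x - y)" by (rule orthogonal_transformation_norm)
  then show ?thesis by (simp add: dist_norm matrix_vector_mult_diff_distrib)
qed

text \<open>
  A proper subspace is a null set, and finitely many null sets do not cover the space.
\<close>

lemma finite_union_subspaces_eq_UNIV:
  fixes V :: "'i \<Rightarrow> 'a::euclidean_space set"
  assumes "finite I" and "\<And>i. i \<in> I \<Longrightarrow> subspace (V i)" and "(\<Union>i\<in>I. V i) = UNIV"
  obtains i where "i \<in> I" and "V i = UNIV"
proof -
  have "\<exists>i\<in>I. V i = UNIV"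
  proof (rule ccontr)
    assume "\<not> (\<exists>i\<in>I. V i = UNIV)"
    then have "negligible (V i)" if "i \<in> I" for i
      using that assms(2) dim_eq_full[of "V i"] dim_subset_UNIV[of "V i"] span_eq_iff[of "V i"]
      by (intro negligible_lowdim) (fastforce simp: less_le)
    then have "negligible (\<Union>i\<in>I. V i)" using assms(1) by (intro negligible_Union) auto
    then show False using assms(3) by simp
  qed
  then show thesis using that by blast
qed

text \<open>
  Orientation-preserving crystallographic groups. Discreteness is only required of the orbit of the
  origin; since the elements are isometries, this controls all orbits.
\<close>

locale rotation_group =
  fixes \<Gamma> :: "(real^'n::finite \<Rightarrow> real^'n) set"
  assumes id_in: "id \<in> \<Gamma>"
    and comp_in: "\<gamma> \<in> \<Gamma> \<Longrightarrow> \<delta> \<in> \<Gamma> \<Longrightarrow> \<gamma> \<circ> \<delta> \<in> \<Gamma>"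
    and inverse_in: "\<gamma> \<in> \<Gamma> \<Longrightarrow> \<exists>\<delta>\<in>\<Gamma>. \<delta> \<circ> \<gamma> = id \<and> \<gamma> \<circ> \<delta> = id"
    and motion: "\<gamma> \<in> \<Gamma> \<Longrightarrow> \<exists>A b. \<gamma> = (\<lambda>x. A *v x + b) \<and> rotation_matrix A"
    and discrete: "finite {\<gamma> \<in> \<Gamma>. norm (\<gamma> 0) \<le> R}"
    and cocompact: "\<exists>K. compact K \<and> (\<forall>x. \<exists>\<gamma>\<in>\<Gamma>. \<gamma> x \<in> K)"
begin

lemma isometry: "\<gamma> \<in> \<Gamma> \<Longrightarrow> dist (\<gamma> x) (\<gamma> y) = dist x y"
  using motion rotation_matrix_dist by metis

lemma continuous_on_motion: "\<gamma> \<in> \<Gamma> \<Longrightarrow> continuous_on S \<gamma>"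
  unfolding continuous_on_iff using isometry by metis

lemma smooth_on_motion: "\<gamma> \<in> \<Gamma> \<Longrightarrow> smooth_on U \<gamma>"
  using motion smooth_on_affine by metis

lemma orbit_eq_iff: "orbit \<Gamma> x = orbit \<Gamma> y \<longleftrightarrow> (\<exists>\<gamma>\<in>\<Gamma>. \<gamma> x = y)"
proof
  assume "orbit \<Gamma> x = orbit \<Gamma> y"
  moreover have "y \<in> orbit \<Gamma> y" unfolding orbit_def using imageI[OF id_in, of "\<lambda>\<gamma>. \<gamma> y"] by simp
  ultimately have "y \<in> (\<lambda>\<gamma>. \<gamma> x) ` \<Gamma>" by (simp add: orbit_def)
  then show "\<exists>\<gamma>\<in>\<Gamma>. \<gamma> x = y" by blast
next
  have sub: "orbit \<Gamma> (\<gamma> x) \<subseteq> orbit \<Gamma> x" if "\<gamma> \<in> \<Gamma>" for \<gamma> x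
  proof
    fix z assume "z \<in> orbit \<Gamma> (\<gamma> x)"
    then obtain \<delta> where "\<delta> \<in> \<Gamma>" "z = (\<delta> \<circ> \<gamma>) x" by (auto simp: orbit_def)
    then show "z \<in> orbit \<Gamma> x" unfolding orbit_def using comp_in[OF _ that] by blast
  qed
  assume "\<exists>\<gamma>\<in>\<Gamma>. \<gamma> x = y"
  then obtain \<gamma> where \<gamma>: "\<gamma> \<in> \<Gamma>" "\<gamma> x = y" by blast
  obtain \<delta> where \<delta>: "\<delta> \<in> \<Gamma>" "\<delta> \<circ> \<gamma> = id" using inverse_in[OF \<gamma>(1)] by blast
  have "\<delta> y = x" using \<delta>(2) \<gamma>(2) by (metis comp_apply id_apply)
  then show "orbit \<Gamma> x = orbit \<Gamma> y" using sub[OF \<gamma>(1), of x] sub[OF \<delta>(1), of y] \<gamma>(2) by auto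
qed

lemma orbit_invariant: "\<gamma> \<in> \<Gamma> \<Longrightarrow> orbit \<Gamma> (\<gamma> x) = orbit \<Gamma> x"
  using orbit_eq_iff by blast

lemma finite_near: "finite {\<gamma> \<in> \<Gamma>. dist (\<gamma> p) q \<le> R}"
proof (rule finite_subset[OF _ discrete])
  show "{\<gamma> \<in> \<Gamma>. dist (\<gamma> p) q \<le> R} \<subseteq> {\<gamma> \<in> \<Gamma>. norm (\<gamma> 0) \<le> dist 0 p + R + norm q}"
  proof clarify
    fix \<gamma> assume "\<gamma> \<in> \<Gamma>" "dist (\<gamma> p) q \<le> R"
    moreover have "dist (\<gamma> 0) 0 \<le> dist (\<gamma> 0) (\<gamma> p) + dist (\<gamma> p) q + dist q 0" by norm
    ultimately show "norm (\<gamma> 0) \<le> dist 0 p + R + norm q" by (simp add: isometry)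
  qed
qed

text \<open>
  The distances from \<open>q\<close> to the points of an orbit other than \<open>q\<close> itself are bounded away from zero,
  because only finitely many of them are at most \<open>1\<close>. The case \<open>q = p\<close> yields the isotropy radius; the
  case of a point \<open>q\<close> on another orbit yields the Hausdorff property of the quotient.
\<close>

lemma orbit_gap: "\<exists>\<delta>>0. \<forall>\<gamma>\<in>\<Gamma>. \<gamma> p \<noteq> q \<longrightarrow> \<delta> \<le> dist (\<gamma> p) q"
proof -
  define D where "D = (\<lambda>\<gamma>. dist (\<gamma> p) q) ` {\<gamma> \<in> \<Gamma>. dist (\<gamma> p) q \<le> 1 \<and> \<gamma> p \<noteq> q}"
  have "finite D"
    unfolding D_def by (intro finite_imageI finite_subset[OF _ finite_near[of p q 1]]) auto
  then have "finite (insert 1 D)" by simp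
  moreover have "\<forall>d\<in>insert 1 D. d > 0" by (auto simp: D_def)
  ultimately have "Min (insert 1 D) > 0" by simp
  moreover have "Min (insert 1 D) \<le> dist (\<gamma> p) q" if "\<gamma> \<in> \<Gamma>" "\<gamma> p \<noteq> q" for \<gamma>
  proof (cases "dist (\<gamma> p) q \<le> 1")
    case True
    then have "dist (\<gamma> p) q \<in> insert 1 D" using that by (auto simp: D_def)
    then show ?thesis using \<open>finite (insert 1 D)\<close> by (intro Min_le)
  next
    case False
    then show ?thesis using Min_le[OF \<open>finite (insert 1 D)\<close>, of 1] by simp
  qed
  ultimately show ?thesis by blast
qed

lemma isotropy_radius:
  "isotropy_radius \<Gamma> p > 0" "\<gamma> \<in> \<Gamma> \<Longrightarrow> \<gamma> p \<noteq> p \<Longrightarrow> 2 * isotropy_radius \<Gamma> p \<le> dist (\<gamma> p) p"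
proof -
  obtain \<delta> where "\<delta> > 0" "\<forall>\<gamma>\<in>\<Gamma>. \<gamma> p \<noteq> p \<longrightarrow> \<delta> \<le> dist (\<gamma> p) p" using orbit_gap by blast
  then have "\<exists>r. r > 0 \<and> (\<forall>\<gamma>\<in>\<Gamma>. \<gamma> p \<noteq> p \<longrightarrow> 2 * r \<le> dist (\<gamma> p) p)"
    by (intro exI[of _ "\<delta> / 2"]) auto
  from someI_ex[OF this] show "isotropy_radius \<Gamma> p > 0"
    "\<gamma> \<in> \<Gamma> \<Longrightarrow> \<gamma> p \<noteq> p \<Longrightarrow> 2 * isotropy_radius \<Gamma> p \<le> dist (\<gamma> p) p"
    unfolding isotropy_radius_def by auto
qed

lemma isotropy_ball_fixes:
  assumes "\<gamma> \<in> \<Gamma>" "x \<in> isotropy_ball \<Gamma> p" "\<gamma> x \<in> isotropy_ball \<Gamma> p"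
  shows "\<gamma> p = p"
proof (rule ccontr)
  assume "\<gamma> p \<noteq> p"
  then have "2 * isotropy_radius \<Gamma> p \<le> dist (\<gamma> p) p" by (rule isotropy_radius(2)[OF assms(1)])
  also have "\<dots> \<le> dist (\<gamma> p) (\<gamma> x) + dist (\<gamma> x) p" by (rule dist_triangle)
  also have "\<dots> < 2 * isotropy_radius \<Gamma> p"
    using assms(2,3) by (simp add: isometry[OF assms(1)] dist_commute)
  finally show False by simp
qed

lemma motion_image_isotropy_ball:
  assumes "\<gamma> \<in> \<Gamma>" "\<gamma> p = p"
  shows "\<gamma> ` isotropy_ball \<Gamma> p = isotropy_ball \<Gamma> p"
proof
  have sub: "\<gamma> ` ball p r \<subseteq> ball p r" if "\<gamma> \<in> \<Gamma>" "\<gamma> p = p" for \<gamma> r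
    using isometry[OF that(1), of p] that(2) by auto
  show "\<gamma> ` isotropy_ball \<Gamma> p \<subseteq> isotropy_ball \<Gamma> p" by (rule sub[OF assms])
  obtain \<delta> where \<delta>: "\<delta> \<in> \<Gamma>" "\<delta> \<circ> \<gamma> = id" "\<gamma> \<circ> \<delta> = id" using inverse_in[OF assms(1)] by blast
  have "\<delta> p = p" using \<delta>(2) assms(2) by (metis comp_apply id_apply)
  then have "\<gamma> ` \<delta> ` isotropy_ball \<Gamma> p \<subseteq> \<gamma> ` isotropy_ball \<Gamma> p"
    by (intro image_mono sub \<delta>(1))
  then show "isotropy_ball \<Gamma> p \<subseteq> \<gamma> ` isotropy_ball \<Gamma> p" by (simp add: image_comp \<delta>(3))
qed

lemma inj_motion: "\<gamma> \<in> \<Gamma> \<Longrightarrow> inj \<gamma>"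
  by (metis injI isometry dist_eq_0_iff)

lemma open_motion_image: assumes "\<gamma> \<in> \<Gamma>" "open U" shows "open (\<gamma> ` U)"
proof -
  obtain \<delta> where \<delta>: "\<delta> \<in> \<Gamma>" "\<delta> \<circ> \<gamma> = id" "\<gamma> \<circ> \<delta> = id" using inverse_in[OF assms(1)] by blast
  have "\<gamma> ` U = \<delta> -` U"
    using \<delta>(2,3) by (auto simp: fun_eq_iff image_iff) metis
  then show ?thesis
    using continuous_on_motion[OF \<delta>(1), of UNIV] assms(2) by (simp add: continuous_on_open_vimage)
qed

lemma open_orbit_image: "open U \<Longrightarrow> openin (orbit_topology \<Gamma>) (orbit \<Gamma> ` U)"
proof -
  assume "open U"
  have "orbit \<Gamma> -` orbit \<Gamma> ` U = (\<Union>\<gamma>\<in>\<Gamma>. \<gamma> ` U)"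
  proof (intro equalityI subsetI)
    fix y assume "y \<in> orbit \<Gamma> -` orbit \<Gamma> ` U"
    then obtain x where "x \<in> U" "orbit \<Gamma> x = orbit \<Gamma> y" by force
    then obtain \<gamma> where "\<gamma> \<in> \<Gamma>" "\<gamma> x = y" using orbit_eq_iff[of x y] by auto
    with \<open>x \<in> U\<close> show "y \<in> (\<Union>\<gamma>\<in>\<Gamma>. \<gamma> ` U)" by blast
  next
    fix y assume "y \<in> (\<Union>\<gamma>\<in>\<Gamma>. \<gamma> ` U)"
    then obtain \<gamma> x where "\<gamma> \<in> \<Gamma>" "x \<in> U" "y = \<gamma> x" by blast
    then show "y \<in> orbit \<Gamma> -` orbit \<Gamma> ` U" by (simp add: orbit_invariant)
  qed
  then show ?thesis
    using open_motion_image[OF _ \<open>open U\<close>] by (auto simp: openin_orbit_topology)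
qed

lemma continuous_map_orbit: "continuous_map euclidean (orbit_topology \<Gamma>) (orbit \<Gamma>)"
  by (auto simp: continuous_map_def openin_orbit_topology vimage_def)

lemma open_map_orbit: "open_map euclidean (orbit_topology \<Gamma>) (orbit \<Gamma>)"
  by (simp add: open_map_def open_orbit_image)

lemma Hausdorff_orbit_topology: "Hausdorff_space (orbit_topology \<Gamma>)"
  unfolding Hausdorff_space_def
proof (intro allI impI, elim conjE)
  fix P Q assume "P \<in> topspace (orbit_topology \<Gamma>)" "Q \<in> topspace (orbit_topology \<Gamma>)" "P \<noteq> Q"
  then obtain x y where xy: "P = orbit \<Gamma> x" "Q = orbit \<Gamma> y" by auto
  obtain \<delta> where \<delta>: "\<delta> > 0" "\<And>\<gamma>. \<gamma> \<in> \<Gamma> \<Longrightarrow> \<delta> \<le> dist (\<gamma> x) y"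
    using orbit_gap[of x y] \<open>P \<noteq> Q\<close> orbit_eq_iff[of x y] unfolding xy by metis
  have "disjnt (orbit \<Gamma> ` ball x (\<delta>/2)) (orbit \<Gamma> ` ball y (\<delta>/2))"
  proof (rule ccontr)
    assume "\<not> disjnt (orbit \<Gamma> ` ball x (\<delta>/2)) (orbit \<Gamma> ` ball y (\<delta>/2))"
    then obtain x' y' where x': "x' \<in> ball x (\<delta>/2)" and y': "y' \<in> ball y (\<delta>/2)"
      and "orbit \<Gamma> x' = orbit \<Gamma> y'" by (auto simp: disjnt_iff)
    then obtain \<gamma> where \<gamma>: "\<gamma> \<in> \<Gamma>" "\<gamma> x' = y'" using orbit_eq_iff by blast
    have "dist (\<gamma> x) y \<le> dist (\<gamma> x) (\<gamma> x') + dist (\<gamma> x') y" by (rule dist_triangle)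
    also have "dist (\<gamma> x) (\<gamma> x') = dist x x'" by (rule isometry[OF \<gamma>(1)])
    also have "dist x x' + dist (\<gamma> x') y < \<delta>" using x' y' by (simp add: \<gamma>(2) dist_commute)
    finally show False using \<delta>(2)[OF \<gamma>(1)] by simp
  qed
  then show "\<exists>U V. openin (orbit_topology \<Gamma>) U \<and> openin (orbit_topology \<Gamma>) V \<and> P \<in> U \<and> Q \<in> V \<and> disjnt U V"
    using \<delta>(1) by (intro exI[of _ "orbit \<Gamma> ` ball x (\<delta>/2)"] exI[of _ "orbit \<Gamma> ` ball y (\<delta>/2)"])
      (simp add: open_orbit_image xy)
qed

lemma second_countable_orbit_topology: "second_countable (orbit_topology \<Gamma>)"
proof (rule second_countable_open_map_image[OF continuous_map_orbit open_map_orbit])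
  show "second_countable (euclidean :: (real^'n) topology)"
  proof -
    obtain B :: "(real^'n) set set" where B: "countable B" "topological_basis B"
      using ex_countable_basis by blast
    have "\<exists>V\<in>B. x \<in> V \<and> V \<subseteq> U" if "open U" "x \<in> U" for U x
      using topological_basisE[OF B(2) that] by metis
    moreover have "\<forall>V\<in>B. open V" using topological_basis_open[OF B(2)] by blast
    ultimately show ?thesis
      unfolding second_countable_def using B(1) by (metis open_openin)
  qed
qed auto

lemma compact_orbit_topology: "compact_space (orbit_topology \<Gamma>)"
proof -
  obtain K where K: "compact K" "\<And>x. \<exists>\<gamma>\<in>\<Gamma>. \<gamma> x \<in> K" using cocompact by blast
  have "compactin (orbit_topology \<Gamma>) (orbit \<Gamma> ` K)"
    using K(1) by (intro image_compactin[OF _ continuous_map_orbit]) simp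
  moreover have "orbit \<Gamma> x \<in> orbit \<Gamma> ` K" for x
    using K(2)[of x] orbit_invariant by (metis imageI)
  then have "orbit \<Gamma> ` K = range (orbit \<Gamma>)" by auto
  ultimately show ?thesis by (simp add: compact_space_def)
qed

lemma connected_orbit_topology: "connected_space (orbit_topology \<Gamma>)"
proof -
  have "connectedin (orbit_topology \<Gamma>) (orbit \<Gamma> ` UNIV)"
    by (intro connectedin_continuous_map_image[OF continuous_map_orbit]) (simp add: convex_connected)
  then show ?thesis by (simp add: connectedin_topspace[symmetric])
qed

lemma isotropy_subgroup:
  "subgroup ((\<lambda>\<gamma>. restrict \<gamma> (isotropy_ball \<Gamma> p)) ` {\<gamma> \<in> \<Gamma>. \<gamma> p = p}) (BijGroup (isotropy_ball \<Gamma> p))"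
proof -
  define U where "U = isotropy_ball \<Gamma> p"
  define H where "H = (\<lambda>\<gamma>. restrict \<gamma> U) ` {\<gamma> \<in> \<Gamma>. \<gamma> p = p}"
  have bij: "bij_betw \<gamma> U U" if "\<gamma> \<in> \<Gamma>" "\<gamma> p = p" for \<gamma>
    using motion_image_isotropy_ball[OF that] inj_motion[OF that(1)]
    by (auto simp: bij_betw_def U_def intro: inj_on_subset)
  then have sub: "H \<subseteq> Bij U"
    by (auto simp: H_def Bij_def cong: bij_betw_cong)
  have maps: "\<gamma> x \<in> U" if "\<gamma> \<in> \<Gamma>" "\<gamma> p = p" "x \<in> U" for \<gamma> x
    using bij[OF that(1,2)] that(3) by (auto simp: bij_betw_def)
  interpret G: group "BijGroup U" by (rule group_BijGroup)
  have "subgroup H (BijGroup U)"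
  proof (rule G.subgroupI)
    show "H \<subseteq> carrier (BijGroup U)" using sub by (simp add: BijGroup_def)
    show "H \<noteq> {}" using id_in by (force simp: H_def)
  next
    fix a assume "a \<in> H"
    then obtain \<gamma> where \<gamma>: "\<gamma> \<in> \<Gamma>" "\<gamma> p = p" "a = restrict \<gamma> U" by (auto simp: H_def)
    obtain \<delta> where \<delta>: "\<delta> \<in> \<Gamma>" "\<delta> \<circ> \<gamma> = id" "\<gamma> \<circ> \<delta> = id" using inverse_in[OF \<gamma>(1)] by blast
    have \<delta>p: "\<delta> p = p" using \<delta>(2) \<gamma>(2) by (metis comp_apply id_apply)
    have d: "restrict \<delta> U \<in> H" using \<delta> \<delta>p by (auto simp: H_def)
    have "compose U (restrict \<delta> U) a = (\<lambda>x\<in>U. x)"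
      using \<delta>(2) maps[OF \<gamma>(1,2)] by (auto simp: \<gamma>(3) compose_def fun_eq_iff)
    then have "inv\<^bsub>BijGroup U\<^esub> a = restrict \<delta> U"
      using d \<open>a \<in> H\<close> sub by (intro G.inv_equality) (auto simp: BijGroup_def)
    then show "inv\<^bsub>BijGroup U\<^esub> a \<in> H" using d by simp
  next
    fix a b assume ab: "a \<in> H" "b \<in> H"
    then obtain \<gamma> \<delta> where \<gamma>: "\<gamma> \<in> \<Gamma>" "\<gamma> p = p" "a = restrict \<gamma> U"
      and \<delta>: "\<delta> \<in> \<Gamma>" "\<delta> p = p" "b = restrict \<delta> U" by (auto simp: H_def)
    have "compose U a b = restrict (\<gamma> \<circ> \<delta>) U"
      using maps[OF \<delta>(1,2)] by (auto simp: \<gamma>(3) \<delta>(3) compose_def fun_eq_iff)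
    moreover have "restrict (\<gamma> \<circ> \<delta>) U \<in> H"
      unfolding H_def by (intro imageI CollectI conjI comp_in \<gamma>(1) \<delta>(1)) (simp add: \<gamma>(2) \<delta>(2))
    ultimately show "a \<otimes>\<^bsub>BijGroup U\<^esub> b \<in> H"
      using ab sub by (auto simp: BijGroup_def)
  qed
  then show ?thesis by (simp add: H_def U_def)
qed

lemma is_orbifold_chart_quotient_chart: "is_orbifold_chart (orbit_topology \<Gamma>) (quotient_chart \<Gamma> p)"
proof -
  let ?U = "isotropy_ball \<Gamma> p"
  have fin: "finite {\<gamma> \<in> \<Gamma>. \<gamma> p = p}"
    using finite_subset[OF _ finite_near[of p p 0], of "{\<gamma> \<in> \<Gamma>. \<gamma> p = p}"] by auto
  have smooth: "smooth_on ?U (restrict \<gamma> ?U)" if "\<gamma> \<in> \<Gamma>" for \<gamma>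
    by (rule smooth_on_cong[OF open_ball _ smooth_on_motion[OF that]]) simp
  have cont: "continuous_map (top_of_set ?U) (subtopology (orbit_topology \<Gamma>) (orbit \<Gamma> ` ?U)) (orbit \<Gamma>)"
    by (auto simp: continuous_map_in_subtopology intro: continuous_map_from_subtopology continuous_map_orbit)
  have openm: "open_map (top_of_set ?U) (subtopology (orbit_topology \<Gamma>) (orbit \<Gamma> ` ?U)) (orbit \<Gamma>)"
    unfolding open_map_def
  proof (intro allI impI)
    fix V assume "openin (top_of_set ?U) V"
    then have V: "open V" "V \<subseteq> ?U" by (simp_all add: openin_open_eq)
    then have "orbit \<Gamma> ` V = orbit \<Gamma> ` V \<inter> orbit \<Gamma> ` ?U" by blast
    then show "openin (subtopology (orbit_topology \<Gamma>) (orbit \<Gamma> ` ?U)) (orbit \<Gamma> ` V)"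
      using open_orbit_image[OF V(1)] unfolding openin_subtopology by blast
  qed
  have "quotient_map (top_of_set ?U) (subtopology (orbit_topology \<Gamma>) (orbit \<Gamma> ` ?U)) (orbit \<Gamma>)"
    by (rule continuous_open_imp_quotient_map[OF cont openm]) auto
  moreover have "orbit \<Gamma> x = orbit \<Gamma> y \<longleftrightarrow> (\<exists>\<gamma>\<in>(\<lambda>\<gamma>. restrict \<gamma> ?U) ` {\<gamma> \<in> \<Gamma>. \<gamma> p = p}. \<gamma> x = y)"
    if "x \<in> ?U" "y \<in> ?U" for x y
    using that isotropy_ball_fixes[of _ x p] by (auto simp: orbit_eq_iff)
  ultimately show ?thesis
    using fin smooth isotropy_radius(1)[of p] isotropy_subgroup
    by (auto simp: is_orbifold_chart_def open_orbit_image)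
qed

lemma diffeomorphism_motion:
  assumes "\<gamma> \<in> \<Gamma>" "open W"
  shows "diffeomorphism W (\<gamma> ` W) \<gamma>"
proof -
  obtain \<delta> where \<delta>: "\<delta> \<in> \<Gamma>" "\<delta> \<circ> \<gamma> = id" "\<gamma> \<circ> \<delta> = id" using inverse_in[OF assms(1)] by blast
  have inj: "inj_on \<gamma> W" using inj_motion[OF assms(1)] by (rule inj_on_subset) simp
  have inv: "\<delta> y = inv_into W \<gamma> y" if "y \<in> \<gamma> ` W" for y
    using that \<delta>(2) inj by (auto simp: fun_eq_iff)
  have "smooth_on (\<gamma> ` W) (inv_into W \<gamma>)"
    by (rule smooth_on_cong[OF open_motion_image[OF assms] inv smooth_on_motion[OF \<delta>(1)]])
  then show ?thesis
    using assms open_motion_image[OF assms] inj smooth_on_motion[OF assms(1)]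
    by (simp add: diffeomorphism_def bij_betw_def)
qed

lemma is_orbifold_quotient_orbifold: "is_orbifold (quotient_orbifold \<Gamma>)"
proof -
  have cover: "(\<Union>p. orbit \<Gamma> ` isotropy_ball \<Gamma> p) = range (orbit \<Gamma>)"
    using isotropy_radius(1) by fastforce
  have "\<exists>W h. chart_transition (quotient_chart \<Gamma> p) (quotient_chart \<Gamma> q) W h \<and> x \<in> W \<and> h x = y"
    if x: "x \<in> isotropy_ball \<Gamma> p" and y: "y \<in> isotropy_ball \<Gamma> q" and eq: "orbit \<Gamma> x = orbit \<Gamma> y" for p q x y
  proof -
    obtain \<gamma> where \<gamma>: "\<gamma> \<in> \<Gamma>" "\<gamma> x = y" using eq orbit_eq_iff by blast
    define W where "W = isotropy_ball \<Gamma> p \<inter> \<gamma> -` isotropy_ball \<Gamma> q"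
    have "open W" unfolding W_def
      using continuous_on_motion[OF \<gamma>(1), of UNIV] by (intro open_Int open_ball open_vimage)
    then have "chart_transition (quotient_chart \<Gamma> p) (quotient_chart \<Gamma> q) W \<gamma>"
      using diffeomorphism_motion[OF \<gamma>(1)] orbit_invariant[OF \<gamma>(1)]
      by (auto simp: chart_transition_def W_def)
    moreover have "x \<in> W" using x y \<gamma>(2) by (simp add: W_def)
    ultimately show ?thesis using \<gamma>(2) by blast
  qed
  then show ?thesis
    using Hausdorff_orbit_topology second_countable_orbit_topology is_orbifold_chart_quotient_chart cover
    by (auto simp: is_orbifold_def)
qed

text \<open>
  A change of charts \<open>h\<close> moves each point within its orbit, but at a singular point the group element
  that does so may vary with the point, so \<open>h\<close> is not given locally by one motion without further
  argument. Its derivative at \<open>x\<close> is nevertheless the linear part of one motion. Near \<open>x\<close> only the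
  finitely many \<open>\<gamma>\<close> with \<open>\<gamma> x = h x\<close> occur, so for every direction \<open>v\<close> the derivative of \<open>h\<close> agrees
  at \<open>v\<close> with the linear part of one of them. The subspaces on which the derivative agrees with these
  linear parts cover \<open>\<real>\<^sup>n\<close>, hence one of them is everything.
\<close>

lemma jacobian_orbit_preserving:
  assumes "open W" "x \<in> W" and diff: "h differentiable at x"
    and orb: "\<And>x. x \<in> W \<Longrightarrow> orbit \<Gamma> (h x) = orbit \<Gamma> x"
  shows "rotation_matrix (jacobian h x)"
proof -
  define L where "L = frechet_derivative h (at x)"
  have L: "(h has_derivative L) (at x)" using diff by (simp add: L_def frechet_derivative_works)
  have "linear L" using L by (rule has_derivative_linear)
  define \<Phi> where "\<Phi> = {\<gamma> \<in> \<Gamma>. \<gamma> x = h x}"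
  have fin: "finite \<Phi>"
    using finite_subset[OF _ finite_near[of x "h x" 0], of \<Phi>] by (auto simp: \<Phi>_def)
  obtain A where A: "\<And>\<gamma>. \<gamma> \<in> \<Gamma> \<Longrightarrow> \<exists>b. \<gamma> = (\<lambda>x. A \<gamma> *v x + b)"
    and rot: "\<And>\<gamma>. \<gamma> \<in> \<Gamma> \<Longrightarrow> rotation_matrix (A \<gamma>)"
    using motion by metis
  obtain \<delta> where \<delta>: "\<delta> > 0" "\<And>\<gamma>. \<gamma> \<in> \<Gamma> \<Longrightarrow> \<gamma> x \<noteq> h x \<Longrightarrow> \<delta> \<le> dist (\<gamma> x) (h x)"
    using orbit_gap[of x "h x"] by blast
  have "(h \<longlongrightarrow> h x) (nhds x)"
    using has_derivative_continuous[OF L] by (simp add: isCont_def tendsto_at_iff_tendsto_nhds)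
  then have "\<forall>\<^sub>F y in nhds x. dist (h y) (h x) < \<delta>/2"
    using \<delta>(1) by (intro tendstoD) auto
  moreover have "\<forall>\<^sub>F y in nhds x. dist y x < \<delta>/2"
    unfolding eventually_nhds_metric using \<delta>(1) by (intro exI[of _ "\<delta>/2"]) auto
  moreover have "\<forall>\<^sub>F y in nhds x. y \<in> W" using assms(1,2) by (rule eventually_nhds_in_open)
  ultimately have near: "\<forall>\<^sub>F y in nhds x. \<exists>\<gamma>\<in>\<Phi>. h y = \<gamma> y"
  proof eventually_elim
    case (elim y)
    obtain \<gamma> where \<gamma>: "\<gamma> \<in> \<Gamma>" "\<gamma> y = h y" using orb[OF elim(3)] orbit_eq_iff by metis
    have "dist (\<gamma> x) (h x) \<le> dist (\<gamma> x) (\<gamma> y) + dist (h y) (h x)"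
      using dist_triangle[of "\<gamma> x" "h x" "\<gamma> y"] \<gamma>(2) by simp
    also have "\<dots> < \<delta>" using elim by (simp add: isometry[OF \<gamma>(1)] dist_commute)
    finally show ?case using \<delta>(2)[OF \<gamma>(1)] \<gamma> by (force simp: \<Phi>_def)
  qed
  have dir: "\<exists>\<gamma>\<in>\<Phi>. L v = A \<gamma> *v v" for v
  proof (rule ccontr)
    assume no: "\<not> (\<exists>\<gamma>\<in>\<Phi>. L v = A \<gamma> *v v)"
    have "\<Phi> \<noteq> {}" using eventually_nhds_x_imp_x[OF near] by blast
    then have "v \<noteq> 0" using no linear_0[OF \<open>linear L\<close>] by auto
    \<comment> \<open>The difference quotients in direction \<open>v\<close> would keep at least this distance from \<open>L v\<close>.\<close>
    define c where "c = Min ((\<lambda>\<gamma>. norm (A \<gamma> *v v - L v)) ` \<Phi>)"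
    have c: "c > 0" using fin \<open>\<Phi> \<noteq> {}\<close> no by (auto simp: c_def)
    have c_le: "c \<le> norm (A \<gamma> *v v - L v)" if "\<gamma> \<in> \<Phi>" for \<gamma>
      using fin that by (auto simp: c_def)
    define e where "e = c / (2 * norm v)"
    have "e > 0" using c \<open>v \<noteq> 0\<close> by (simp add: e_def)
    then obtain d where d: "d > 0"
      "\<And>y. norm (y - x) < d \<Longrightarrow> norm (h y - h x - L (y - x)) \<le> e * norm (y - x)"
      using L unfolding has_derivative_at_alt by blast
    obtain d' where d': "d' > 0" "\<And>y. dist y x < d' \<Longrightarrow> \<exists>\<gamma>\<in>\<Phi>. h y = \<gamma> y"
      using near unfolding eventually_nhds_metric by blast
    define t where "t = min d d' / (2 * norm v)"
    have t: "t > 0" using d(1) d'(1) \<open>v \<noteq> 0\<close> by (simp add: t_def)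
    have tv: "norm (t *\<^sub>R v) < d" "norm (t *\<^sub>R v) < d'"
      using d(1) d'(1) \<open>v \<noteq> 0\<close> t by (auto simp: t_def)
    have "dist (x + t *\<^sub>R v) x < d'" using tv by (simp add: dist_norm)
    then obtain \<gamma> where \<gamma>: "\<gamma> \<in> \<Phi>" "h (x + t *\<^sub>R v) = \<gamma> (x + t *\<^sub>R v)" using d'(2) by blast
    obtain b where b: "\<gamma> = (\<lambda>x. A \<gamma> *v x + b)" using A \<gamma>(1) by (auto simp: \<Phi>_def)
    have "h (x + t *\<^sub>R v) - h x = t *\<^sub>R (A \<gamma> *v v)"
    proof -
      have "h x = A \<gamma> *v x + b" using \<gamma>(1) b unfolding \<Phi>_def by (metis (mono_tags, lifting) mem_Collect_eq)
      moreover have "h (x + t *\<^sub>R v) = A \<gamma> *v (x + t *\<^sub>R v) + b" using \<gamma>(2) b by metis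
      ultimately show ?thesis by (simp add: matrix_vector_right_distrib matrix_vector_mult_scaleR)
    qed
    then have "norm (t *\<^sub>R (A \<gamma> *v v - L v)) \<le> e * norm (t *\<^sub>R v)"
      using d(2)[of "x + t *\<^sub>R v"] tv(1) linear_scale[OF \<open>linear L\<close>]
      by (simp add: scaleR_diff_right)
    then have "norm (A \<gamma> *v v - L v) \<le> e * norm v" using t by simp
    also have "\<dots> = c / 2" using \<open>v \<noteq> 0\<close> by (simp add: e_def)
    finally show False using c c_le[OF \<gamma>(1)] by simp
  qed
  have "subspace {v. L v = A \<gamma> *v v}" for \<gamma>
    using \<open>linear L\<close> by (auto simp: subspace_def linear_0 linear_add linear_scale
        matrix_vector_right_distrib matrix_vector_mult_scaleR)
  moreover have "(\<Union>\<gamma>\<in>\<Phi>. {v. L v = A \<gamma> *v v}) = UNIV" using dir by auto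
  ultimately obtain \<gamma> where "\<gamma> \<in> \<Phi>" "{v. L v = A \<gamma> *v v} = UNIV"
    using finite_union_subspaces_eq_UNIV[OF fin, of "\<lambda>\<gamma>. {v. L v = A \<gamma> *v v}"] by blast
  then have "L = (\<lambda>v. A \<gamma> *v v)" by (auto simp: fun_eq_iff)
  then have "jacobian h x = A \<gamma>" by (simp add: jacobian_def L_def[symmetric])
  then show ?thesis using rot \<open>\<gamma> \<in> \<Phi>\<close> by (simp add: \<Phi>_def)
qed

lemma chart_transition_rotation:
  assumes "chart_transition (quotient_chart \<Gamma> p) (quotient_chart \<Gamma> q) W h" "x \<in> W"
  shows "rotation_matrix (jacobian h x)"
proof (rule jacobian_orbit_preserving)
  show "open W" "x \<in> W" using assms by (auto simp: chart_transition_def diffeomorphism_def)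
  show "h differentiable at x"
    using assms by (auto simp: chart_transition_def diffeomorphism_def intro: smooth_on_differentiable)
  show "orbit \<Gamma> (h x) = orbit \<Gamma> x" if "x \<in> W" for x
    using assms that by (simp add: chart_transition_def)
qed

theorem closed_oriented_riemannian_orbifold_quotient_orbifold:
  "closed_oriented_riemannian_orbifold (quotient_orbifold \<Gamma>)"
proof -
  have "is_riemannian_orbifold (quotient_orbifold \<Gamma>)"
    using is_orbifold_quotient_orbifold chart_transition_rotation
    by (auto simp: is_riemannian_orbifold_def smooth_on_const rotation_matrix_def orthogonal_matrix)
  moreover have "is_oriented (quotient_orbifold \<Gamma>)"
    using chart_transition_rotation by (auto simp: is_oriented_def rotation_matrix_def)
  ultimately show ?thesis
    by (simp add: closed_oriented_riemannian_orbifold_def compact_orbit_topology connected_orbit_topology)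
qed

theorem closed_oriented_riemannian_manifold_quotient_orbifold:
  assumes free: "\<And>\<gamma> x. \<gamma> \<in> \<Gamma> \<Longrightarrow> \<gamma> x = x \<Longrightarrow> \<gamma> = id"
  shows "closed_oriented_riemannian_manifold (quotient_orbifold \<Gamma>)"
proof -
  have "{\<gamma> \<in> \<Gamma>. \<gamma> p = p} = {id}" for p using free id_in by auto
  then show ?thesis
    using closed_oriented_riemannian_orbifold_quotient_orbifold
    by (simp add: closed_oriented_riemannian_manifold_def restrict_def id_def)
qed

text \<open>
  The local group consists of restrictions to a ball, so a motion \<open>\<gamma> \<noteq> id\<close> must be shown to move a
  point of that ball. An affine map that is the identity on a ball is the identity: every \<open>x\<close> can be
  shrunk towards the center into the ball.
\<close>

lemma singular_point_quotient_orbifold: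
  assumes \<gamma>: "\<gamma> \<in> \<Gamma>" "\<gamma> \<noteq> id" and p: "\<gamma> p = p"
  shows "orbit \<Gamma> p \<in> singular_points (quotient_orbifold \<Gamma>)"
proof -
  let ?U = "isotropy_ball \<Gamma> p"
  have "restrict \<gamma> ?U \<noteq> (\<lambda>z\<in>?U. z)"
  proof
    assume eq: "restrict \<gamma> ?U = (\<lambda>z\<in>?U. z)"
    have fixed: "\<gamma> z = z" if "z \<in> ?U" for z using fun_cong[OF eq, of z] that by simp
    obtain A b where \<gamma>A: "\<gamma> = (\<lambda>x. A *v x + b)" using motion[OF \<gamma>(1)] by blast
    have "\<gamma> x = x" for x
    proof -
      define t where "t = isotropy_radius \<Gamma> p / (1 + dist x p)"
      have pos: "isotropy_radius \<Gamma> p > 0" by (rule isotropy_radius)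
      have t: "t > 0" using pos by (simp add: t_def add_pos_nonneg)
      have "t * dist x p < isotropy_radius \<Gamma> p"
        using pos by (simp add: t_def field_simps add_pos_nonneg)
      then have "p + t *\<^sub>R (x - p) \<in> ?U" using t by (simp add: dist_norm norm_minus_commute)
      then have "A *v (p + t *\<^sub>R (x - p)) + b = p + t *\<^sub>R (x - p)" using fixed \<gamma>A by metis
      moreover have Ap: "A *v p + b = p" using p \<gamma>A by metis
      moreover have "A *v (p + t *\<^sub>R (x - p)) + b = (A *v p + b) + t *\<^sub>R (A *v x - A *v p)"
        by (simp add: matrix_vector_right_distrib matrix_vector_mult_scaleR
            matrix_vector_mult_diff_distrib)
      ultimately have "t *\<^sub>R (A *v x - A *v p) = t *\<^sub>R (x - p)"
        by (metis add_left_cancel)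
      then have "A *v x - A *v p = x - p" using t by simp
      then have "A *v x = x - p + A *v p" by (metis diff_add_cancel)
      then show ?thesis using Ap by (simp add: \<gamma>A add.assoc)
    qed
    then show False using \<gamma>(2) by auto
  qed
  then show ?thesis
    using \<gamma>(1) p isotropy_radius(1)[of p] unfolding singular_points_def
    by (auto intro!: exI[of _ p])
qed

text \<open>
  All charts share the quotient map and the Euclidean metric, and their domains cover \<open>\<real>\<^sup>n\<close>. The
  conditions on the charts hence add up to one condition on the global lift.
\<close>

lemma laplace_eigenspace_quotient_orbifold:
  "f \<in> laplace_eigenspace (quotient_orbifold \<Gamma>) \<mu> \<longleftrightarrow>
     (\<forall>P. P \<notin> range (orbit \<Gamma>) \<longrightarrow> f P = 0) \<and> smooth_on UNIV (f \<circ> orbit \<Gamma>) \<and>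
     (\<forall>x. flat_laplacian (f \<circ> orbit \<Gamma>) x = \<mu> * (f \<circ> orbit \<Gamma>) x)"
proof -
  have cover: "(\<Union>p\<in>UNIV. isotropy_ball \<Gamma> p) = UNIV" using isotropy_radius(1) by fastforce
  have smooth: "(\<forall>p. smooth_on (isotropy_ball \<Gamma> p) F) \<longleftrightarrow> smooth_on UNIV F" for F :: "real^'n \<Rightarrow> real"
  proof
    assume "\<forall>p. smooth_on (isotropy_ball \<Gamma> p) F"
    then have "smooth_on (\<Union>p\<in>UNIV. isotropy_ball \<Gamma> p) F" by (intro smooth_on_UN) auto
    then show "smooth_on UNIV F" by (simp only: cover)
  next
    assume "smooth_on UNIV F"
    then show "\<forall>p. smooth_on (isotropy_ball \<Gamma> p) F" by (blast intro: smooth_on_subset)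
  qed
  have all: "(\<forall>p. \<forall>x\<in>isotropy_ball \<Gamma> p. Q x) \<longleftrightarrow> (\<forall>x. Q x)" for Q
    using cover by blast
  have "f \<in> laplace_eigenspace (quotient_orbifold \<Gamma>) \<mu> \<longleftrightarrow>
     (\<forall>P. P \<notin> range (orbit \<Gamma>) \<longrightarrow> f P = 0) \<and> (\<forall>p. smooth_on (isotropy_ball \<Gamma> p) (f \<circ> orbit \<Gamma>)) \<and>
     (\<forall>p. \<forall>x\<in>isotropy_ball \<Gamma> p. flat_laplacian (f \<circ> orbit \<Gamma>) x = \<mu> * (f \<circ> orbit \<Gamma>) x)"
    unfolding laplace_eigenspace_def mem_Collect_eq quotient_orbifold_simps topspace_orbit_topology
      ball_simps quotient_chart_simps laplacian_mat_1 all_conj_distrib comp_apply ..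
  then show ?thesis unfolding smooth all .
qed

definition invariant_eigenfunctions :: "real \<Rightarrow> (real^'n \<Rightarrow> real) set" where
  "invariant_eigenfunctions \<mu> = {F. (\<forall>\<gamma>\<in>\<Gamma>. \<forall>x. F (\<gamma> x) = F x) \<and> smooth_on UNIV F \<and>
     (\<forall>x. flat_laplacian F x = \<mu> * F x)}"

text \<open>
  Lifting is an isomorphism from the eigenspace of the quotient to the invariant eigenfunctions on
  \<open>\<real>\<^sup>n\<close>. After it, quotients of \<open>\<real>\<^sup>n\<close> by different groups can be compared in one function space.
\<close>

lemma dim_laplace_eigenspace:
  "function_space.dim (laplace_eigenspace (quotient_orbifold \<Gamma>) \<mu>) =
    function_space.dim (invariant_eigenfunctions \<mu>)"
proof -
  define E where "E = laplace_eigenspace (quotient_orbifold \<Gamma>) \<mu>"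
  define lift :: "((real^'n) set \<Rightarrow> real) \<Rightarrow> real^'n \<Rightarrow> real" where "lift f = f \<circ> orbit \<Gamma>" for f
  interpret P: vector_space_pair "\<lambda>(r::real) (f::(real^'n) set \<Rightarrow> real) p. r * f p"
      "\<lambda>(r::real) (f::real^'n \<Rightarrow> real) p. r * f p"
    by unfold_locales
  have lin: "Vector_Spaces.linear (\<lambda>(r::real) (f::(real^'n) set \<Rightarrow> real) p. r * f p)
      (\<lambda>(r::real) (f::real^'n \<Rightarrow> real) p. r * f p) lift"
    unfolding Vector_Spaces.linear_iff
    by (intro conjI function_space.vector_space_axioms) (auto simp: lift_def fun_eq_iff)
  have image: "lift ` E = invariant_eigenfunctions \<mu>"
  proof (intro equalityI subsetI)
    fix F assume "F \<in> lift ` E"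
    then show "F \<in> invariant_eigenfunctions \<mu>"
      by (auto simp: E_def lift_def laplace_eigenspace_quotient_orbifold invariant_eigenfunctions_def
          orbit_invariant)
  next
    fix F assume F: "F \<in> invariant_eigenfunctions \<mu>"
    define f where "f P = (if P \<in> range (orbit \<Gamma>) then F (SOME x. orbit \<Gamma> x = P) else 0)" for P
    have "f (orbit \<Gamma> x) = F x" for x
    proof -
      have "orbit \<Gamma> (SOME y. orbit \<Gamma> y = orbit \<Gamma> x) = orbit \<Gamma> x" by (rule someI) simp
      then obtain \<gamma> where "\<gamma> \<in> \<Gamma>" "\<gamma> (SOME y. orbit \<Gamma> y = orbit \<Gamma> x) = x"
        using orbit_eq_iff by blast
      then have "F (SOME y. orbit \<Gamma> y = orbit \<Gamma> x) = F x"
        using F unfolding invariant_eigenfunctions_def by (metis (mono_tags, lifting) mem_Collect_eq)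
      then show ?thesis by (simp add: f_def)
    qed
    then have "f \<circ> orbit \<Gamma> = F" by auto
    moreover have "f \<in> E"
      using F \<open>f \<circ> orbit \<Gamma> = F\<close>
      by (simp add: E_def laplace_eigenspace_quotient_orbifold invariant_eigenfunctions_def f_def)
    ultimately show "F \<in> lift ` E" by (auto simp: lift_def)
  qed
  have zero: "\<forall>P. P \<notin> range (orbit \<Gamma>) \<longrightarrow> f P = 0" if "f \<in> function_space.span E" for f
    using that
  proof (induction rule: function_space.span_induct_alt)
    case base
    show ?case by simp
  next
    case (step c g h)
    then show ?case by (auto simp: E_def laplace_eigenspace_quotient_orbifold)
  qed
  have inj: "inj_on lift (function_space.span E)"
  proof (rule inj_onI)
    fix f g assume f: "f \<in> function_space.span E" and g: "g \<in> function_space.span E" and eq: "lift f = lift g"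
    show "f = g"
    proof
      fix P show "f P = g P"
      proof (cases "P \<in> range (orbit \<Gamma>)")
        case True
        then show ?thesis using fun_cong[OF eq] by (auto simp: lift_def)
      next
        case False
        then show ?thesis using zero[OF f] zero[OF g] by metis
      qed
    qed
  qed
  obtain B where B: "B \<subseteq> E" "function_space.independent B" "E \<subseteq> function_space.span B"
      "card B = function_space.dim E"
    using function_space.basis_exists by blast
  have span: "function_space.span B \<subseteq> function_space.span E"
    using B(1) by (rule function_space.span_mono)
  have "function_space.independent (lift ` B)"
    using lin B(2) inj span by (intro P.linear_independent_injective_image) (auto intro: inj_on_subset)
  moreover have "lift ` E \<subseteq> function_space.span (lift ` B)"
    using P.linear_span_image[OF lin, of B] B(3) by auto
  moreover have "card (lift ` B) = card B"
    using inj B(1) function_space.span_superset[of E] by (intro card_image) (meson inj_on_subset order_trans)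
  ultimately have "function_space.dim (lift ` E) = card B"
    using B(1) by (intro function_space.dim_unique[of "lift ` B"]) auto
  then show ?thesis using B(4) unfolding image by (simp add: E_def)
qed

end

section \<open>Counting eigenvalues\<close>

text \<open>
  A multiset of reals with finitely many elements below every bound is listed in nondecreasing order:
  the \<open>k\<close>th element is the one at which the number of elements up to it, counted with multiplicity
  \<open>d\<close>, first reaches \<open>k\<close>. Describing the list by this property, instead of by a recursion, makes
  it evident that its initial part depends only on the small elements.
\<close>

lemma enumeration_with_multiplicity:
  fixes d :: "real \<Rightarrow> nat"
  defines "D \<equiv> {\<mu>. \<mu> \<noteq> 0 \<and> d \<mu> \<noteq> 0}"
  assumes fin: "\<And>C. finite (D \<inter> {..C})" and inf: "infinite D"
  shows "\<exists>lam. lam 0 = 0 \<and>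
    (\<forall>k\<ge>1. \<forall>\<mu>. lam k = \<mu> \<longleftrightarrow> \<mu> \<in> D \<and> sum d (D \<inter> {..<\<mu>}) < k \<and> k \<le> sum d (D \<inter> {..\<mu>}))"
proof -
  have fin': "finite (D \<inter> {..<C})" for C
    using fin[of C] by (rule rev_finite_subset) auto
  have le_less: "sum d (D \<inter> {..\<nu>}) \<le> sum d (D \<inter> {..<\<mu>})" if "\<nu> < \<mu>" for \<mu> \<nu>
    using that by (intro sum_mono2 fin') auto
  have ex: "\<exists>\<mu>. \<mu> \<in> D \<and> sum d (D \<inter> {..<\<mu>}) < k \<and> k \<le> sum d (D \<inter> {..\<mu>})" if k: "k \<ge> 1" for k
  proof -
    obtain F where F: "F \<subseteq> D" "finite F" "card F = k"
      using inf infinite_arbitrarily_large by blast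
    then have Fne: "F \<noteq> {}" using k by auto
    define \<mu>0 where "\<mu>0 = Max F"
    have F0: "F \<subseteq> D \<inter> {..\<mu>0}" using F by (auto simp: \<mu>0_def)
    have "card F \<le> card (D \<inter> {..\<mu>0})" using F0 fin by (intro card_mono)
    also have "\<dots> \<le> sum d (D \<inter> {..\<mu>0})"
      unfolding card_eq_sum by (intro sum_mono) (auto simp: D_def Suc_le_eq)
    finally have k0: "k \<le> sum d (D \<inter> {..\<mu>0})" using F by simp
    \<comment> \<open>The least candidate exists because there are only finitely many up to any given one.\<close>
    define E where "E = {\<mu> \<in> D \<inter> {..\<mu>0}. k \<le> sum d (D \<inter> {..\<mu>})}"
    have E: "finite E" "\<mu>0 \<in> E"
      unfolding E_def using fin[of \<mu>0] k0 F Max_in[OF F(2) Fne] by (auto simp: \<mu>0_def simp del: Int_iff)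
    define \<mu> where "\<mu> = Min E"
    have \<mu>E: "\<mu> \<in> E" using E unfolding \<mu>_def by (intro Min_in) auto
    have "sum d (D \<inter> {..<\<mu>}) < k"
    proof (rule ccontr)
      assume *: "\<not> sum d (D \<inter> {..<\<mu>}) < k"
      then have ne: "D \<inter> {..<\<mu>} \<noteq> {}" using k by auto
      define \<nu> where "\<nu> = Max (D \<inter> {..<\<mu>})"
      have \<nu>: "\<nu> \<in> D \<inter> {..<\<mu>}" unfolding \<nu>_def using ne fin' by (intro Max_in)
      moreover have "D \<inter> {..<\<mu>} \<subseteq> D \<inter> {..\<nu>}"
        using fin'[of \<mu>] by (auto simp: \<nu>_def)
      then have "sum d (D \<inter> {..<\<mu>}) \<le> sum d (D \<inter> {..\<nu>})" by (intro sum_mono2 fin) auto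
      ultimately have "\<nu> \<in> E" using * \<mu>E by (auto simp: E_def)
      then have "\<mu> \<le> \<nu>" using E by (simp add: \<mu>_def)
      with \<nu> show False by auto
    qed
    with \<mu>E show ?thesis by (auto simp: E_def)
  qed
  have uniq: "\<mu> = \<nu>" if "sum d (D \<inter> {..<\<mu>}) < k \<and> k \<le> sum d (D \<inter> {..\<mu>})"
    "sum d (D \<inter> {..<\<nu>}) < k \<and> k \<le> sum d (D \<inter> {..\<nu>})" for k \<mu> \<nu>
    using that le_less[of \<mu> \<nu>] le_less[of \<nu> \<mu>] by linarith
  define lam where "lam k = (if k = 0 then 0 else
    SOME \<mu>. \<mu> \<in> D \<and> sum d (D \<inter> {..<\<mu>}) < k \<and> k \<le> sum d (D \<inter> {..\<mu>}))" for k :: nat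
  have "lam k \<in> D \<and> sum d (D \<inter> {..<lam k}) < k \<and> k \<le> sum d (D \<inter> {..lam k})" if "k \<ge> 1" for k
    using someI_ex[OF ex[OF that]] that by (simp add: lam_def)
  with uniq have "\<forall>k\<ge>1. \<forall>\<mu>. lam k = \<mu> \<longleftrightarrow> \<mu> \<in> D \<and> sum d (D \<inter> {..<\<mu>}) < k \<and> k \<le> sum d (D \<inter> {..\<mu>})"
    by blast
  then show ?thesis by (intro exI[of _ lam]) (simp add: lam_def)
qed

text \<open>
  If the spectrum is infinite and has finitely many elements below every bound, the enumeration with
  the dimensions of the eigenspaces as multiplicities lists it. As such a list is unique, the definite
  description \<open>laplace_eigenvalue\<close> is this enumeration.
\<close>

lemma laplace_eigenvalue_eq_iff:
  fixes P :: "('a, 'n::finite) riem_orbifold"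
  defines "d \<mu> \<equiv> function_space.dim (laplace_eigenspace P \<mu>)"
  defines "D \<equiv> {\<mu>. \<mu> \<noteq> 0 \<and> d \<mu> \<noteq> 0}"
  assumes fin: "\<And>C. finite (D \<inter> {..C})" and inf: "infinite D"
  shows "laplace_eigenvalue P 0 = 0"
    and "k \<ge> 1 \<Longrightarrow> laplace_eigenvalue P k = \<mu> \<longleftrightarrow>
      \<mu> \<in> D \<and> sum d (D \<inter> {..<\<mu>}) < k \<and> k \<le> sum d (D \<inter> {..\<mu>})"
proof -
  obtain lam where lam0: "lam 0 = 0" and lam: "\<And>k \<mu>. k \<ge> 1 \<Longrightarrow>
      lam k = \<mu> \<longleftrightarrow> \<mu> \<in> D \<and> sum d (D \<inter> {..<\<mu>}) < k \<and> k \<le> sum d (D \<inter> {..\<mu>})"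
    using enumeration_with_multiplicity[of d] fin inf unfolding D_def by blast
  have fin': "finite (D \<inter> {..<C})" for C
    using fin[of C] by (rule rev_finite_subset) auto
  have mono: "lam k \<le> lam l" if "1 \<le> k" "k \<le> l" for k l
  proof (rule ccontr)
    assume "\<not> lam k \<le> lam l"
    then have "sum d (D \<inter> {..lam l}) \<le> sum d (D \<inter> {..<lam k})"
      by (intro sum_mono2 fin') auto
    then show False using lam[of k "lam k"] lam[of l "lam l"] that by linarith
  qed
  have level: "{k. 1 \<le> k \<and> lam k = \<mu>} = (if \<mu> \<in> D then {sum d (D \<inter> {..<\<mu>})<..sum d (D \<inter> {..\<mu>})} else {})" for \<mu>
  proof -
    have "1 \<le> k \<and> lam k = \<mu> \<longleftrightarrow> \<mu> \<in> D \<and> sum d (D \<inter> {..<\<mu>}) < k \<and> k \<le> sum d (D \<inter> {..\<mu>})" for k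
    proof (cases "k = 0")
      case False
      then show ?thesis using lam[of k \<mu>] by simp
    qed simp
    then have "{k. 1 \<le> k \<and> lam k = \<mu>} = {k. \<mu> \<in> D \<and> sum d (D \<inter> {..<\<mu>}) < k \<and> k \<le> sum d (D \<inter> {..\<mu>})}"
      by (rule Collect_cong)
    also have "\<dots> = (if \<mu> \<in> D then {sum d (D \<inter> {..<\<mu>})<..sum d (D \<inter> {..\<mu>})} else {})"
      by (simp only: greaterThanAtMost_def greaterThan_def atMost_def) auto
    finally show ?thesis .
  qed
  have step: "sum d (D \<inter> {..\<mu>}) = sum d (D \<inter> {..<\<mu>}) + d \<mu>" if "\<mu> \<in> D" for \<mu>
  proof -
    have "D \<inter> {..\<mu>} = insert \<mu> (D \<inter> {..<\<mu>})" using that by auto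
    then show ?thesis using fin' by simp
  qed
  have card: "finite {k. 1 \<le> k \<and> lam k = \<mu>} \<and> card {k. 1 \<le> k \<and> lam k = \<mu>} = d \<mu>" if "\<mu> \<noteq> 0" for \<mu>
    using that step[of \<mu>] unfolding level by (auto simp: D_def)
  have "lists_laplace_spectrum P lam"
    unfolding lists_laplace_spectrum_def
  proof (intro conjI allI impI)
    show "lam k \<noteq> 0" if "k \<ge> 1" for k
      using lam[OF that, of 0] by (simp add: D_def)
    show "mono_on {1..} lam" using mono by (auto intro!: mono_onI)
  qed (use lam0 card in \<open>auto simp: d_def\<close>)
  then have "laplace_eigenvalue P = lam"
    unfolding laplace_eigenvalue_def using lists_laplace_spectrum_unique by blast
  with lam0 lam show "laplace_eigenvalue P 0 = 0" "k \<ge> 1 \<Longrightarrow> laplace_eigenvalue P k = \<mu> \<longleftrightarrow>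
      \<mu> \<in> D \<and> sum d (D \<inter> {..<\<mu>}) < k \<and> k \<le> sum d (D \<inter> {..\<mu>})"
    by simp_all
qed

text \<open>
  If the spectra agree below \<open>K\<close> and contain at least \<open>N\<close> nonzero elements there, then the first \<open>N\<close>
  eigenvalues are determined by the part of the spectrum below \<open>K\<close>.
\<close>

lemma laplace_eigenvalue_cong_below:
  fixes P :: "('a, 'n::finite) riem_orbifold" and Q :: "('b, 'm::finite) riem_orbifold"
  defines "d \<mu> \<equiv> function_space.dim (laplace_eigenspace P \<mu>)"
    and "e \<mu> \<equiv> function_space.dim (laplace_eigenspace Q \<mu>)"
  defines "D \<equiv> {\<mu>. \<mu> \<noteq> 0 \<and> d \<mu> \<noteq> 0}" and "E \<equiv> {\<mu>. \<mu> \<noteq> 0 \<and> e \<mu> \<noteq> 0}"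
  assumes finD: "\<And>C. finite (D \<inter> {..C})" and infD: "infinite D"
    and finE: "\<And>C. finite (E \<inter> {..C})" and infE: "infinite E"
    and eq: "\<And>\<mu>. \<mu> \<noteq> 0 \<Longrightarrow> \<mu> < K \<Longrightarrow> d \<mu> = e \<mu>"
    and N: "N \<le> card (D \<inter> {..<K})" and k: "k \<le> N"
  shows "laplace_eigenvalue P k = laplace_eigenvalue Q k"
proof (cases "k = 0")
  case True
  then show ?thesis
    using laplace_eigenvalue_eq_iff(1)[of P] laplace_eigenvalue_eq_iff(1)[of Q] finD infD finE infE
    unfolding D_def E_def d_def e_def by simp
next
  case False
  define \<mu> where "\<mu> = laplace_eigenvalue P k"
  have \<mu>: "\<mu> \<in> D" "sum d (D \<inter> {..<\<mu>}) < k" "k \<le> sum d (D \<inter> {..\<mu>})"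
    using laplace_eigenvalue_eq_iff(2)[of P k \<mu>] finD infD False \<mu>_def
    unfolding D_def d_def by simp_all
  have fin': "finite (D \<inter> {..<C})" for C
    using finD[of C] by (rule rev_finite_subset) auto
  have "\<mu> < K"
  proof (rule ccontr)
    assume "\<not> \<mu> < K"
    then have "card (D \<inter> {..<K}) \<le> card (D \<inter> {..<\<mu>})" using fin' by (intro card_mono) auto
    also have "\<dots> \<le> sum d (D \<inter> {..<\<mu>})"
      unfolding card_eq_sum by (intro sum_mono) (auto simp: D_def Suc_le_eq)
    finally show False using \<mu> N k by simp
  qed
  then have "D \<inter> {..\<mu>} = E \<inter> {..\<mu>}" "D \<inter> {..<\<mu>} = E \<inter> {..<\<mu>}"
    using eq by (auto simp: D_def E_def)
  moreover have "sum d (E \<inter> {..\<mu>}) = sum e (E \<inter> {..\<mu>})" "sum d (E \<inter> {..<\<mu>}) = sum e (E \<inter> {..<\<mu>})"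
    using eq \<open>\<mu> < K\<close> by (auto simp: E_def intro!: sum.cong)
  ultimately have "\<mu> \<in> E \<and> sum e (E \<inter> {..<\<mu>}) < k \<and> k \<le> sum e (E \<inter> {..\<mu>})"
    using \<mu> by auto
  then have "laplace_eigenvalue Q k = \<mu>"
    using laplace_eigenvalue_eq_iff(2)[of Q k \<mu>] finE infE False
    unfolding E_def e_def by simp
  then show ?thesis by (simp add: \<mu>_def)
qed

section \<open>Periodic functions and integration over a period\<close>

text \<open>
  The lattice with the sides \<open>a\<close>. It serves both as the lattice of periods and, with sides
  \<open>2\<pi> / L\<^sub>i\<close>, as the dual lattice of frequencies.
\<close>

definition scaled_lattice :: "real^'n \<Rightarrow> (real^'n) set" where
  "scaled_lattice a = {x. \<forall>i. \<exists>k::int. x $ i = of_int k * a $ i}"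

lemma scaled_lattice_0: "0 \<in> scaled_lattice a"
  unfolding scaled_lattice_def by (auto intro: exI[of _ 0])

lemma scaled_lattice_add:
  assumes "x \<in> scaled_lattice a" "y \<in> scaled_lattice a"
  shows "x + y \<in> scaled_lattice a"
  unfolding scaled_lattice_def
proof (intro CollectI allI)
  fix i
  obtain k l :: int where "x $ i = of_int k * a $ i" "y $ i = of_int l * a $ i"
    using assms unfolding scaled_lattice_def by blast
  then show "\<exists>m::int. (x + y) $ i = of_int m * a $ i"
    by (intro exI[of _ "k + l"]) (simp add: algebra_simps)
qed

lemma scaled_lattice_minus:
  assumes "x \<in> scaled_lattice a"
  shows "- x \<in> scaled_lattice a"
  unfolding scaled_lattice_def
proof (intro CollectI allI)
  fix i
  obtain k :: int where "x $ i = of_int k * a $ i"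
    using assms unfolding scaled_lattice_def by blast
  then show "\<exists>m::int. (- x) $ i = of_int m * a $ i"
    by (intro exI[of _ "- k"]) simp
qed

lemma scaled_lattice_diff:
  "x \<in> scaled_lattice a \<Longrightarrow> y \<in> scaled_lattice a \<Longrightarrow> x - y \<in> scaled_lattice a"
  using scaled_lattice_add[of x a "- y"] scaled_lattice_minus[of y a] by simp

lemma scaled_lattice_axis: "axis i (of_int k * a $ i) \<in> scaled_lattice a"
  unfolding scaled_lattice_def
proof (intro CollectI allI)
  fix j show "\<exists>m::int. axis i (of_int k * a $ i) $ j = of_int m * a $ j"
    by (cases "j = i") (auto simp: axis_def intro: exI[of _ 0])
qed

lemma finite_scaled_lattice_bounded:
  assumes a: "\<And>i. a $ i > 0"
  shows "finite {x \<in> scaled_lattice a. norm x \<le> R}"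
proof -
  define M where "M i = \<lceil>R / a $ i\<rceil>" for i
  have "{x \<in> scaled_lattice a. norm x \<le> R} \<subseteq>
      (\<lambda>k. \<chi> i. of_int (k i) * a $ i) ` (\<Pi>\<^sub>E i\<in>UNIV. {- M i..M i})"
  proof
    fix x assume x: "x \<in> {x \<in> scaled_lattice a. norm x \<le> R}"
    then obtain k :: "'a \<Rightarrow> int" where k: "\<And>i. x $ i = of_int (k i) * a $ i"
      unfolding scaled_lattice_def by (auto simp: choice_iff)
    have "k i \<in> {- M i..M i}" for i
    proof -
      have "\<bar>x $ i\<bar> \<le> R" using component_le_norm_cart[of x i] x by simp
      then have "\<bar>real_of_int (k i)\<bar> \<le> R / a $ i"
        using a[of i] by (simp add: k abs_mult field_simps)
      then show ?thesis unfolding M_def by (simp, linarith)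
    qed
    moreover have "x = (\<chi> i. of_int (k i) * a $ i)" by (simp add: vec_eq_iff k)
    ultimately show "x \<in> (\<lambda>k. \<chi> i. of_int (k i) * a $ i) ` (\<Pi>\<^sub>E i\<in>UNIV. {- M i..M i})"
      by blast
  qed
  then show ?thesis by (rule finite_subset) (intro finite_imageI finite_PiE; simp)
qed

lemma frechet_derivative_periodic:
  assumes "\<And>x. f (x + c) = f x" and "f differentiable at x"
  shows "frechet_derivative f (at (x + c)) = frechet_derivative f (at x)"
proof -
  have f: "(\<lambda>y. f (y - c)) = f" using assms(1)[of "_ - c"] by (auto simp: fun_eq_iff)
  have "((\<lambda>y. f (y - c)) has_derivative frechet_derivative f (at x)) (at (x + c))"
    by (rule has_derivative_compose[of "\<lambda>y. y - c" "\<lambda>h. h" "x + c" UNIV f "frechet_derivative f (at x)"])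
      (use assms(2) in \<open>auto intro!: derivative_eq_intros simp: frechet_derivative_works\<close>)
  then show ?thesis using frechet_derivative_at unfolding f by metis
qed

locale period_box =
  fixes L :: "real^'n::finite"
  assumes L_pos: "L $ i > 0"
begin

definition periodic :: "(real^'n \<Rightarrow> real) \<Rightarrow> bool" where
  "periodic f \<longleftrightarrow> (\<forall>x. \<forall>v\<in>scaled_lattice L. f (x + v) = f x)"

definition frequencies :: "(real^'n) set" where
  "frequencies = scaled_lattice (\<chi> i. 2 * pi / L $ i)"

lemma periodic_axis: "periodic f \<Longrightarrow> f (x + (of_int k * L $ i) *\<^sub>R axis i 1) = f x"
  using scaled_lattice_axis[of i k L] axis_def
  by (auto simp: periodic_def scaleR_vec_def axis_def if_distrib cong: if_cong)

lemma periodic_partial: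
  assumes "periodic f" and "\<And>x. f differentiable at x"
  shows "periodic (partial i f)"
  unfolding periodic_def partial_def
  using assms frechet_derivative_periodic[of f] by (metis periodic_def)

lemma inner_lattice_frequency:
  assumes "\<xi> \<in> frequencies" "v \<in> scaled_lattice L"
  shows "\<exists>m::int. \<xi> \<bullet> v = 2 * pi * of_int m"
proof -
  obtain k :: "'n \<Rightarrow> int" where k: "\<And>i. \<xi> $ i = of_int (k i) * (2 * pi / L $ i)"
    using assms(1) unfolding frequencies_def scaled_lattice_def by (auto simp: choice_iff)
  obtain l :: "'n \<Rightarrow> int" where l: "\<And>i. v $ i = of_int (l i) * L $ i"
    using assms(2) unfolding scaled_lattice_def by (auto simp: choice_iff)
  have "\<xi> $ i * v $ i = 2 * pi * of_int (k i * l i)" for i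
    using L_pos[of i] by (simp add: k l)
  then have "\<xi> \<bullet> v = 2 * pi * of_int (\<Sum>i\<in>UNIV. k i * l i)"
    by (simp add: inner_vec_def sum_distrib_left)
  then show ?thesis by blast
qed

lemma periodic_trig:
  assumes "\<xi> \<in> frequencies"
  shows "periodic (\<lambda>x. cos (\<xi> \<bullet> x))" "periodic (\<lambda>x. sin (\<xi> \<bullet> x))"
proof -
  have "cos (\<xi> \<bullet> (x + v)) = cos (\<xi> \<bullet> x) \<and> sin (\<xi> \<bullet> (x + v)) = sin (\<xi> \<bullet> x)"
    if v: "v \<in> scaled_lattice L" for x v
  proof -
    obtain m :: int where "\<xi> \<bullet> v = 2 * pi * of_int m" using inner_lattice_frequency[OF assms v] by blast
    then have "\<xi> \<bullet> (x + v) = \<xi> \<bullet> x + 2 * pi * of_int m" by (simp add: inner_add_right)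
    then show ?thesis using sin_cos_eq_iff by metis
  qed
  then show "periodic (\<lambda>x. cos (\<xi> \<bullet> x))" "periodic (\<lambda>x. sin (\<xi> \<bullet> x))"
    by (simp_all add: periodic_def)
qed

lemma cbox_split:
  assumes "0 \<le> c" "c \<le> L $ i"
  shows "cbox 0 L \<inter> {x. x \<bullet> axis i 1 \<le> c} = cbox 0 (L + (c - L $ i) *\<^sub>R axis i 1)"
    and "cbox 0 L \<inter> {x. x \<bullet> axis i 1 \<ge> c} = cbox (c *\<^sub>R axis i 1) L"
proof -
  have upper: "(L + (c - L $ i) *\<^sub>R axis i 1) $ j = (if j = i then c else L $ j)"
    and lower: "(c *\<^sub>R axis i 1 :: real^'n) $ j = (if j = i then c else 0)" for j
    by (simp_all add: axis_def)
  have "x \<in> cbox 0 L \<and> x $ i \<le> c \<longleftrightarrow> x \<in> cbox 0 (L + (c - L $ i) *\<^sub>R axis i 1)" for x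
  proof -
    have "x $ j \<le> L $ j \<and> x $ i \<le> c \<longleftrightarrow> x $ j \<le> (if j = i then c else L $ j) \<and> x $ i \<le> c" for j
      using assms(2) by auto
    moreover have "(\<forall>j. x $ j \<le> (if j = i then c else L $ j)) \<Longrightarrow> x $ i \<le> c"
      by (drule spec[of _ i]) simp
    ultimately show ?thesis unfolding mem_box_cart upper by meson
  qed
  moreover have "x \<in> cbox 0 L \<and> x $ i \<ge> c \<longleftrightarrow> x \<in> cbox (c *\<^sub>R axis i 1) L" for x
  proof -
    have "0 \<le> x $ j \<and> x $ i \<ge> c \<longleftrightarrow> (if j = i then c else 0) \<le> x $ j \<and> x $ i \<ge> c" for j
      using assms(1) by auto
    moreover have "(\<forall>j. (if j = i then c else 0) \<le> x $ j) \<Longrightarrow> x $ i \<ge> c"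
      by (drule spec[of _ i]) simp
    ultimately show ?thesis unfolding mem_box_cart lower zero_index by meson
  qed
  ultimately show "cbox 0 L \<inter> {x. x \<bullet> axis i 1 \<le> c} = cbox 0 (L + (c - L $ i) *\<^sub>R axis i 1)"
    "cbox 0 L \<inter> {x. x \<bullet> axis i 1 \<ge> c} = cbox (c *\<^sub>R axis i 1) L"
    by (auto simp: inner_axis)
qed

text \<open>
  The shifted box is cut at a face of the period box, and the part that sticks out is moved back by
  one period.
\<close>

lemma integral_shift_nonneg:
  fixes f :: "real^'n \<Rightarrow> real"
  assumes cont: "continuous_on UNIV f" and per: "periodic f" and t: "0 \<le> t" "t \<le> L $ i"
  shows "integral (cbox 0 L) (\<lambda>x. f (x + t *\<^sub>R axis i 1)) = integral (cbox 0 L) f"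
proof -
  let ?e = "axis i 1 :: real^'n" and ?l = "L $ i"
  let ?g = "\<lambda>x. f (x + t *\<^sub>R ?e)"
  have e: "?e \<in> Basis" by (simp add: axis_in_Basis_iff)
  have int_f: "f integrable_on cbox 0 L"
    by (rule integrable_continuous) (rule continuous_on_subset[OF cont], simp)
  have "continuous_on UNIV ?g"
    by (rule continuous_on_compose2[OF cont]) (auto intro!: continuous_intros)
  then have int_g: "?g integrable_on cbox 0 L"
    by (intro integrable_continuous) (auto intro: continuous_on_subset)
  have per': "f (x + (t - ?l) *\<^sub>R ?e) = f (x + t *\<^sub>R ?e)" for x
    using periodic_axis[OF per, of "x + t *\<^sub>R ?e" "-1" i] by (simp add: scaleR_diff_left add_diff_eq)
  have "integral (cbox 0 L) ?g =
      integral (cbox 0 (L + (?l - t - ?l) *\<^sub>R ?e)) ?g + integral (cbox ((?l - t) *\<^sub>R ?e) L) ?g"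
    using integral_split[OF int_g e, of "?l - t"] cbox_split[of "?l - t" i] t by simp
  also have "integral (cbox 0 (L + (?l - t - ?l) *\<^sub>R ?e)) ?g = integral (cbox (t *\<^sub>R ?e) L) f"
    using integral_shift_cbox_plus[of 0 "L + (?l - t - ?l) *\<^sub>R ?e" f "t *\<^sub>R ?e"]
    by (simp add: o_def add.commute)
  also have "integral (cbox ((?l - t) *\<^sub>R ?e) L) ?g =
      integral (cbox ((?l - t) *\<^sub>R ?e) L) (f \<circ> (+) ((t - ?l) *\<^sub>R ?e))"
    using per' by (simp add: o_def add.commute)
  also have "\<dots> = integral (cbox 0 (L + (t - ?l) *\<^sub>R ?e)) f"
    using integral_shift_cbox_plus[of "(?l - t) *\<^sub>R ?e" L f "(t - ?l) *\<^sub>R ?e"]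
    by (simp add: scaleR_diff_left)
  finally show ?thesis
    using integral_split[OF int_f e, of t] cbox_split[of t i] t by simp
qed

lemma integral_shift_axis:
  fixes f :: "real^'n \<Rightarrow> real"
  assumes cont: "continuous_on UNIV f" and per: "periodic f" and t: "\<bar>t\<bar> \<le> L $ i"
  shows "integral (cbox 0 L) (\<lambda>x. f (x + t *\<^sub>R axis i 1)) = integral (cbox 0 L) f"
proof (cases "t \<ge> 0")
  case True
  then show ?thesis using integral_shift_nonneg[OF cont per] t by simp
next
  case False
  have "f (x + (t + L $ i) *\<^sub>R axis i 1) = f (x + t *\<^sub>R axis i 1)" for x
    using periodic_axis[OF per, of "x + t *\<^sub>R axis i 1" 1 i] by (simp add: scaleR_add_left add.assoc)
  then show ?thesis using integral_shift_nonneg[OF cont per, of "t + L $ i" i] t False by simp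
qed

text \<open>
  Integration by parts without boundary terms. The integral of \<open>f\<close> over the shifted box is constant in
  the shift, and the derivative of this constant under the integral sign is the integral of the
  partial derivative.
\<close>

lemma integral_partial:
  fixes f :: "real^'n \<Rightarrow> real"
  assumes diff: "\<And>x. f differentiable at x" and cont: "continuous_on UNIV (partial i f)"
    and per: "periodic f"
  shows "integral (cbox 0 L) (partial i f) = 0"
proof -
  let ?e = "axis i 1 :: real^'n" and ?U = "{- L $ i<..<L $ i}"
  have cf: "continuous_on UNIV f"
    using diff by (auto intro!: continuous_at_imp_continuous_on differentiable_imp_continuous_within)
  have der: "((\<lambda>t. f (x + t *\<^sub>R ?e)) has_field_derivative partial i f (x + t *\<^sub>R ?e)) (at t within ?U)" for x t
  proof -
    let ?D = "frechet_derivative f (at (x + t *\<^sub>R ?e))"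
    have D: "(f has_derivative ?D) (at (x + t *\<^sub>R ?e))" using diff by (simp add: frechet_derivative_works)
    have "((\<lambda>t. f (x + t *\<^sub>R ?e)) has_derivative (\<lambda>s. ?D (s *\<^sub>R ?e))) (at t within ?U)"
      by (rule has_derivative_compose[of "\<lambda>t. x + t *\<^sub>R ?e" "\<lambda>s. s *\<^sub>R ?e" t ?U f ?D, OF _ D])
        (auto intro!: derivative_eq_intros)
    moreover have "(\<lambda>s. ?D (s *\<^sub>R ?e)) = (*) (partial i f (x + t *\<^sub>R ?e))"
      using linear_scale[OF has_derivative_linear[OF D]] by (auto simp: partial_def fun_eq_iff)
    ultimately show ?thesis by (simp add: has_field_derivative_def)
  qed
  have "((\<lambda>t. integral (cbox 0 L) (\<lambda>x. f (x + t *\<^sub>R ?e))) has_field_derivative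
      integral (cbox 0 L) (\<lambda>x. partial i f (x + 0 *\<^sub>R ?e))) (at 0 within ?U)"
  proof (rule leibniz_rule_field_derivative[OF der])
    show "(\<lambda>x. f (x + t *\<^sub>R ?e)) integrable_on cbox 0 L" for t
      by (intro integrable_continuous continuous_on_compose2[OF cf]) (auto intro!: continuous_intros)
    show "continuous_on (?U \<times> cbox 0 L) (\<lambda>(t, x). partial i f (x + t *\<^sub>R ?e))"
      unfolding split_beta by (rule continuous_on_compose2[OF cont]) (auto intro!: continuous_intros)
    show "0 \<in> ?U" using L_pos by simp
  qed simp
  then have "((\<lambda>t. integral (cbox 0 L) (\<lambda>x. f (x + t *\<^sub>R ?e))) has_field_derivative
      integral (cbox 0 L) (partial i f)) (at 0)"
    using L_pos[of i] by (simp add: at_within_open[of 0 ?U])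
  moreover have "((\<lambda>t. integral (cbox 0 L) (\<lambda>x. f (x + t *\<^sub>R ?e))) has_field_derivative 0) (at 0)"
  proof (rule has_field_derivative_transform_within_open[of "\<lambda>t. integral (cbox 0 L) f" 0 0 ?U])
    show "integral (cbox 0 L) f = integral (cbox 0 L) (\<lambda>x. f (x + t *\<^sub>R ?e))" if "t \<in> ?U" for t
      using integral_shift_axis[OF cf per, of t i] that by auto
  qed (use L_pos[of i] in auto)
  ultimately show ?thesis by (rule DERIV_unique)
qed

text \<open>
  The inner product of \<open>L\<^sup>2\<close> of the torus.
\<close>

definition ip :: "(real^'n \<Rightarrow> real) \<Rightarrow> (real^'n \<Rightarrow> real) \<Rightarrow> real" where
  "ip f g = integral (cbox 0 L) (\<lambda>x. f x * g x)"

lemma integrable_on_box: "continuous_on UNIV f \<Longrightarrow> f integrable_on cbox 0 L" for f :: "real^'n \<Rightarrow> real"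
  by (intro integrable_continuous) (auto intro: continuous_on_subset)

lemma ip_commute: "ip f g = ip g f"
  by (simp add: ip_def mult.commute)

lemma ip_combine:
  assumes "continuous_on UNIV f" "continuous_on UNIV g" "continuous_on UNIV h"
  shows "ip (\<lambda>x. f x + c * g x) h = ip f h + c * ip g h"
proof -
  have "(\<lambda>x. f x * h x) integrable_on cbox 0 L" "(\<lambda>x. c * (g x * h x)) integrable_on cbox 0 L"
    using assms by (intro integrable_on_box continuous_intros; simp)+
  then have "integral (cbox 0 L) (\<lambda>x. f x * h x + c * (g x * h x)) = ip f h + c * ip g h"
    by (simp add: integral_add ip_def)
  then show ?thesis by (simp add: ip_def algebra_simps)
qed

text \<open>
  The Laplacian is symmetric by Green's formula: the difference of \<open>\<Delta>f g\<close> and \<open>f \<Delta>g\<close> is the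
  divergence of the periodic field with components \<open>f \<partial>\<^sub>i g - g \<partial>\<^sub>i f\<close>, so its integral vanishes.
  Eigenfunctions for different eigenvalues are therefore orthogonal.
\<close>

lemma ip_eigenfunctions:
  assumes f: "smooth_on UNIV f" "periodic f" "\<And>x. flat_laplacian f x = \<mu> * f x"
    and g: "smooth_on UNIV g" "periodic g" "\<And>x. flat_laplacian g x = \<nu> * g x"
    and "\<mu> \<noteq> \<nu>"
  shows "ip f g = 0"
proof -
  have diff: "f differentiable at x" "g differentiable at x"
    "partial i f differentiable at x" "partial i g differentiable at x" for i x
    using smooth_on_differentiable[OF f(1)] smooth_on_differentiable[OF g(1)]
      smooth_on_differentiable[OF smooth_on_partial[OF f(1)]]
      smooth_on_differentiable[OF smooth_on_partial[OF g(1)]] by simp_all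
  have cont: "continuous_on UNIV f" "continuous_on UNIV g"
    "continuous_on UNIV (partial i (partial i f))" "continuous_on UNIV (partial i (partial i g))" for i
    by (intro smooth_on_imp_continuous_on smooth_on_partial f(1) g(1))+
  let ?w = "\<lambda>i x. partial i f x * g x - f x * partial i g x"
  let ?w' = "\<lambda>i x. partial i (partial i f) x * g x - f x * partial i (partial i g) x"
  have der: "(?w i has_derivative (\<lambda>v. partial i f x * frechet_derivative g (at x) v
      + frechet_derivative (partial i f) (at x) v * g x
      - (f x * frechet_derivative (partial i g) (at x) v + frechet_derivative f (at x) v * partial i g x))) (at x)" for i x
    by (intro has_derivative_diff has_derivative_mult) (simp_all add: frechet_derivative_works[symmetric] diff)
  have partial_w: "partial i (?w i) = ?w' i" for i
  proof
    fix x show "partial i (?w i) x = ?w' i x"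
      unfolding partial_def[of i "?w i"] frechet_derivative_at[OF der, symmetric]
      by (simp add: partial_def[symmetric])
  qed
  have cw: "continuous_on UNIV (?w' i)" for i by (intro continuous_intros cont)
  have "integral (cbox 0 L) (?w' i) = 0" for i
    unfolding partial_w[symmetric]
  proof (rule integral_partial)
    show "?w i differentiable at x" for x using der unfolding differentiable_def by blast
    show "continuous_on UNIV (partial i (?w i))" unfolding partial_w by (rule cw)
    show "periodic (?w i)"
      using f(2) g(2) periodic_partial[OF f(2), of i] periodic_partial[OF g(2), of i] diff
      by (simp add: periodic_def)
  qed
  then have "integral (cbox 0 L) (\<lambda>x. \<Sum>i\<in>UNIV. ?w' i x) = 0"
    using cw by (subst integral_sum) (auto intro!: integrable_on_box)
  moreover have "(\<Sum>i\<in>UNIV. ?w' i x) = (\<nu> - \<mu>) * (f x * g x)" for x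
  proof -
    have "(\<Sum>i\<in>UNIV. ?w' i x) = - flat_laplacian f x * g x + f x * flat_laplacian g x"
      by (simp add: flat_laplacian_def sum_subtractf sum_distrib_left sum_distrib_right)
    then show ?thesis by (simp add: f(3) g(3) algebra_simps)
  qed
  ultimately show ?thesis using \<open>\<mu> \<noteq> \<nu>\<close> by (simp add: ip_def)
qed

end

section \<open>Trigonometric series of eigenfunctions\<close>

lemma sum_apply: "(\<Sum>i\<in>I. f i) x = (\<Sum>i\<in>I. f i x)" for f :: "'i \<Rightarrow> 'a \<Rightarrow> real"
  by (induction I rule: infinite_finite_induct) auto

lemma span_combine:
  assumes "f \<in> function_space.span S" "g \<in> function_space.span S"
  shows "(\<lambda>x. a * f x + b * g x) \<in> function_space.span S"
proof -
  have "(\<lambda>x. a * f x) + (\<lambda>x. b * g x) \<in> function_space.span S"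
    by (intro function_space.span_add function_space.span_scale assms)
  then show ?thesis by (simp add: plus_fun_def)
qed

lemma span_scaled: "f \<in> function_space.span S \<Longrightarrow> (\<lambda>x. a * f x) \<in> function_space.span S"
  using span_combine[of f S f a 0] by simp

text \<open>
  Sums and multiples are written out pointwise, since the properties to which this induction is
  applied (continuity, periodicity, integrals) are stated for functions given in this form.
\<close>

lemma span_closed_induct [consumes 1, case_names zero combine]:
  assumes "f \<in> function_space.span S" and "P (\<lambda>x. 0)"
    and "\<And>c g h. g \<in> S \<Longrightarrow> h \<in> function_space.span S \<Longrightarrow> P h \<Longrightarrow> P (\<lambda>x. h x + c * g x)"
  shows "P f"
proof -
  have "f \<in> function_space.span S \<and> P f"
    using assms(1)
  proof (induction rule: function_space.span_induct_alt)
    case base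
    show ?case using assms(2) function_space.span_zero[of S] by (simp add: zero_fun_def)
  next
    case (step c g h)
    have "P (\<lambda>x. h x + c * g x)" using step assms(3) by blast
    moreover have "(\<lambda>x. c * g x) + h \<in> function_space.span S"
      using step by (intro function_space.span_add span_scaled) (auto intro: function_space.span_base)
    ultimately show ?case by (simp add: plus_fun_def add.commute)
  qed
  then show ?thesis ..
qed

definition trig :: "'a::real_inner set \<Rightarrow> ('a \<Rightarrow> real) set" where
  "trig \<Xi> = (\<Union>\<xi>\<in>\<Xi>. {\<lambda>x. cos (\<xi> \<bullet> x), \<lambda>x. sin (\<xi> \<bullet> x)})"

lemma finite_trig: "finite \<Xi> \<Longrightarrow> finite (trig \<Xi>)"
  by (simp add: trig_def)

lemma continuous_on_span_trig: "f \<in> function_space.span (trig \<Xi>) \<Longrightarrow> continuous_on S f"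
  by (induction rule: span_closed_induct) (auto simp: trig_def intro!: continuous_intros)

lemma trig_mult:
  assumes add: "\<And>\<xi> \<eta>. \<xi> \<in> \<Xi> \<Longrightarrow> \<eta> \<in> \<Xi> \<Longrightarrow> \<xi> + \<eta> \<in> \<Xi>"
    and diff: "\<And>\<xi> \<eta>. \<xi> \<in> \<Xi> \<Longrightarrow> \<eta> \<in> \<Xi> \<Longrightarrow> \<xi> - \<eta> \<in> \<Xi>"
    and "f \<in> trig \<Xi>" "g \<in> trig \<Xi>"
  shows "(\<lambda>x. f x * g x) \<in> function_space.span (trig \<Xi>)"
proof -
  have c: "(\<lambda>x. cos (\<xi> \<bullet> x)) \<in> function_space.span (trig \<Xi>)"
    and s: "(\<lambda>x. sin (\<xi> \<bullet> x)) \<in> function_space.span (trig \<Xi>)" if "\<xi> \<in> \<Xi>" for \<xi>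
    using that by (auto intro!: function_space.span_base simp: trig_def)
  obtain \<xi> \<eta> where \<xi>: "\<xi> \<in> \<Xi>" "f = (\<lambda>x. cos (\<xi> \<bullet> x)) \<or> f = (\<lambda>x. sin (\<xi> \<bullet> x))"
    and \<eta>: "\<eta> \<in> \<Xi>" "g = (\<lambda>x. cos (\<eta> \<bullet> x)) \<or> g = (\<lambda>x. sin (\<eta> \<bullet> x))"
    using assms(3,4) by (auto simp: trig_def)
  have p: "\<xi> + \<eta> \<in> \<Xi>" and m: "\<xi> - \<eta> \<in> \<Xi>" using add diff \<xi>(1) \<eta>(1) by auto
  have eqs:
    "(\<lambda>x. cos (\<xi> \<bullet> x) * cos (\<eta> \<bullet> x)) = (\<lambda>x. (1/2) * cos ((\<xi> - \<eta>) \<bullet> x) + (1/2) * cos ((\<xi> + \<eta>) \<bullet> x))"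
    "(\<lambda>x. sin (\<xi> \<bullet> x) * sin (\<eta> \<bullet> x)) = (\<lambda>x. (1/2) * cos ((\<xi> - \<eta>) \<bullet> x) + (- (1/2)) * cos ((\<xi> + \<eta>) \<bullet> x))"
    "(\<lambda>x. sin (\<xi> \<bullet> x) * cos (\<eta> \<bullet> x)) = (\<lambda>x. (1/2) * sin ((\<xi> - \<eta>) \<bullet> x) + (1/2) * sin ((\<xi> + \<eta>) \<bullet> x))"
    "(\<lambda>x. cos (\<xi> \<bullet> x) * sin (\<eta> \<bullet> x)) = (\<lambda>x. (- (1/2)) * sin ((\<xi> - \<eta>) \<bullet> x) + (1/2) * sin ((\<xi> + \<eta>) \<bullet> x))"
    by (simp_all add: fun_eq_iff inner_diff_left inner_add_left cos_add cos_diff sin_add sin_diff field_simps)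
  from \<xi>(2) \<eta>(2) consider "f = (\<lambda>x. cos (\<xi> \<bullet> x))" "g = (\<lambda>x. cos (\<eta> \<bullet> x))"
    | "f = (\<lambda>x. sin (\<xi> \<bullet> x))" "g = (\<lambda>x. sin (\<eta> \<bullet> x))"
    | "f = (\<lambda>x. sin (\<xi> \<bullet> x))" "g = (\<lambda>x. cos (\<eta> \<bullet> x))"
    | "f = (\<lambda>x. cos (\<xi> \<bullet> x))" "g = (\<lambda>x. sin (\<eta> \<bullet> x))" by blast
  then show ?thesis
    by cases (simp_all only: eqs span_combine c[OF p] c[OF m] s[OF p] s[OF m])
qed

lemma span_trig_mult:
  assumes add: "\<And>\<xi> \<eta>. \<xi> \<in> \<Xi> \<Longrightarrow> \<eta> \<in> \<Xi> \<Longrightarrow> \<xi> + \<eta> \<in> \<Xi>"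
    and diff: "\<And>\<xi> \<eta>. \<xi> \<in> \<Xi> \<Longrightarrow> \<eta> \<in> \<Xi> \<Longrightarrow> \<xi> - \<eta> \<in> \<Xi>"
    and f: "f \<in> function_space.span (trig \<Xi>)" and g: "g \<in> function_space.span (trig \<Xi>)"
  shows "(\<lambda>x. f x * g x) \<in> function_space.span (trig \<Xi>)"
  using f
proof (induction rule: span_closed_induct)
  case zero
  show ?case using function_space.span_zero[of "trig \<Xi>"] by (simp add: zero_fun_def)
next
  case (combine c p q)
  have "(\<lambda>x. p x * g x) \<in> function_space.span (trig \<Xi>)"
    using g
  proof (induction rule: span_closed_induct)
    case zero
    show ?case using function_space.span_zero[of "trig \<Xi>"] by (simp add: zero_fun_def)
  next
    case (combine c r h)
    then show ?case
      using span_combine[OF combine(3) trig_mult[OF add diff \<open>p \<in> trig \<Xi>\<close> combine(1)], of 1 c]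
      by (simp add: algebra_simps)
  qed
  then show ?case
    using span_combine[OF combine(3), of "\<lambda>x. p x * g x" 1 c] by (simp add: algebra_simps)
qed

context period_box
begin

lemma frequencies_closed:
  "\<xi> \<in> frequencies \<Longrightarrow> \<eta> \<in> frequencies \<Longrightarrow> \<xi> + \<eta> \<in> frequencies"
  "\<xi> \<in> frequencies \<Longrightarrow> \<eta> \<in> frequencies \<Longrightarrow> \<xi> - \<eta> \<in> frequencies"
  unfolding frequencies_def by (simp_all add: scaled_lattice_add scaled_lattice_diff)

text \<open>
  The embedding of the torus as a product of circles. Real polynomials on \<open>\<complex>\<^sup>n\<close> pull back under it to
  trigonometric polynomials, and continuous periodic functions are exactly the pullbacks of
  continuous functions on its image.
\<close>

definition torus_map :: "real^'n \<Rightarrow> complex^'n" where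
  "torus_map x = (\<chi> i. cis (2 * pi / L $ i * x $ i))"

lemma torus_map_eq_iff: "torus_map x = torus_map y \<longleftrightarrow> x - y \<in> scaled_lattice L"
proof -
  have "cis (2 * pi / L $ i * x $ i) = cis (2 * pi / L $ i * y $ i) \<longleftrightarrow>
      (\<exists>k::int. (x - y) $ i = of_int k * L $ i)" for i
  proof -
    have "cis (2 * pi / L $ i * x $ i) = cis (2 * pi / L $ i * y $ i) \<longleftrightarrow>
        (\<exists>k::int. 2 * pi / L $ i * x $ i = 2 * pi / L $ i * y $ i + 2 * pi * of_int k)"
      unfolding complex_eq_iff cis.sel using sin_cos_eq_iff by metis
    also have "\<dots> \<longleftrightarrow> (\<exists>k::int. (x - y) $ i = of_int k * L $ i)"
    proof (intro ex_cong1)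
      fix k :: int
      have "2 * pi / L $ i * x $ i = 2 * pi / L $ i * y $ i + 2 * pi * of_int k \<longleftrightarrow>
          2 * pi * (x $ i) = 2 * pi * (y $ i + of_int k * L $ i)"
        using L_pos[of i] by (simp add: field_simps)
      also have "\<dots> \<longleftrightarrow> (x - y) $ i = of_int k * L $ i" by auto
      finally show "2 * pi / L $ i * x $ i = 2 * pi / L $ i * y $ i + 2 * pi * of_int k \<longleftrightarrow>
          (x - y) $ i = of_int k * L $ i" .
    qed
    finally show ?thesis .
  qed
  then show ?thesis by (simp add: torus_map_def vec_eq_iff scaled_lattice_def)
qed

lemma torus_map_Basis_in_span:
  assumes "b \<in> Basis"
  shows "(\<lambda>x. torus_map x \<bullet> b) \<in> function_space.span (trig frequencies)"
proof -
  obtain i u where b: "b = axis i u" "u \<in> Basis" using assms by (auto simp: Basis_vec_def)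
  have "axis i (2 * pi / L $ i) \<in> frequencies"
    using scaled_lattice_axis[of i 1 "\<chi> i. 2 * pi / L $ i"] by (simp add: frequencies_def)
  moreover have "axis i (2 * pi / L $ i) \<bullet> x = 2 * pi / L $ i * x $ i" for x :: "real^'n"
    by (simp add: inner_axis' )
  ultimately have "(\<lambda>x. cos (2 * pi / L $ i * x $ i)) \<in> trig frequencies"
    "(\<lambda>x. sin (2 * pi / L $ i * x $ i)) \<in> trig frequencies"
    unfolding trig_def by (auto intro!: bexI[of _ "axis i (2 * pi / L $ i)"])
  moreover have "u = 1 \<or> u = \<i>" using b(2) by (simp add: Basis_complex_def)
  then have "(\<lambda>x. torus_map x \<bullet> b) = (\<lambda>x. cos (2 * pi / L $ i * x $ i)) \<or>
      (\<lambda>x. torus_map x \<bullet> b) = (\<lambda>x. sin (2 * pi / L $ i * x $ i))"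
    by (auto simp: b(1) inner_axis torus_map_def inner_complex_def fun_eq_iff)
  ultimately show ?thesis by (auto intro: function_space.span_base)
qed

lemma polynomial_torus_map_in_span:
  assumes "real_polynomial_function g"
  shows "(\<lambda>x. g (torus_map x)) \<in> function_space.span (trig frequencies)"
  using assms
proof induction
  case (linear f)
  have "(\<lambda>x. f (torus_map x)) = (\<Sum>b\<in>Basis. (\<lambda>x. f b * (torus_map x \<bullet> b)))"
  proof
    fix x
    have "f (torus_map x) = f (\<Sum>b\<in>Basis. (torus_map x \<bullet> b) *\<^sub>R b)" by (simp add: euclidean_representation)
    also have "\<dots> = (\<Sum>b\<in>Basis. f b * (torus_map x \<bullet> b))"
      using linear by (simp add: linear_sum linear_scale bounded_linear.linear mult.commute)
    finally show "f (torus_map x) = (\<Sum>b\<in>Basis. (\<lambda>x. f b * (torus_map x \<bullet> b))) x"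
      by (simp add: sum_apply)
  qed
  then show ?case
    by (simp only:) (intro function_space.span_sum span_scaled torus_map_Basis_in_span)
next
  case (const c)
  have "(\<lambda>x. cos (0 \<bullet> x)) \<in> trig frequencies"
    unfolding trig_def frequencies_def using scaled_lattice_0 by blast
  then have "(\<lambda>x. c * cos (0 \<bullet> x)) \<in> function_space.span (trig frequencies)"
    by (intro span_scaled function_space.span_base)
  then show ?case by simp
next
  case (add f g)
  then show ?case using span_combine[OF add.IH, of 1 1] by simp
next
  case (mult f g)
  show ?case by (rule span_trig_mult[OF frequencies_closed mult.IH])
qed

lemma fundamental_box: "\<exists>v\<in>scaled_lattice L. x + v \<in> cbox 0 L"
proof -
  define v where "v = (\<chi> i. of_int (- \<lfloor>x $ i / L $ i\<rfloor>) * L $ i)"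
  have "v \<in> scaled_lattice L"
    unfolding scaled_lattice_def
  proof (intro CollectI allI)
    show "\<exists>k::int. v $ i = of_int k * L $ i" for i
      by (intro exI[of _ "- \<lfloor>x $ i / L $ i\<rfloor>"]) (simp add: v_def)
  qed
  moreover have "0 \<le> (x + v) $ i \<and> (x + v) $ i \<le> L $ i" for i
  proof -
    have "of_int \<lfloor>x $ i / L $ i\<rfloor> \<le> x $ i / L $ i" "x $ i / L $ i \<le> of_int \<lfloor>x $ i / L $ i\<rfloor> + 1"
      by linarith+
    then have "of_int \<lfloor>x $ i / L $ i\<rfloor> * L $ i \<le> x $ i" "x $ i \<le> (of_int \<lfloor>x $ i / L $ i\<rfloor> + 1) * L $ i"
      by (simp_all only: pos_le_divide_eq[OF L_pos] pos_divide_le_eq[OF L_pos])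
    then show ?thesis by (simp add: v_def algebra_simps)
  qed
  ultimately show ?thesis by (auto simp: mem_box_cart)
qed

text \<open>
  Stone-Weierstrass on the compact image of the torus. The function \<open>G\<close> to be approximated there is
  continuous because the period box is compact, so that the torus map on it is a quotient map.
\<close>

lemma span_trig_dense:
  assumes cont: "continuous_on UNIV f" and per: "periodic f" and "e > 0"
  shows "\<exists>p\<in>function_space.span (trig frequencies). \<forall>x\<in>cbox 0 L. \<bar>f x - p x\<bar> < e"
proof -
  let ?B = "cbox 0 L" and ?S = "torus_map ` cbox 0 L"
  have cE: "continuous_on ?B torus_map"
    unfolding torus_map_def by (intro continuous_intros)
  have q: "quotient_map (top_of_set ?B) (top_of_set ?S) torus_map"
    using cE by (intro continuous_imp_quotient_map)
      (auto simp: compact_space_subtopology Hausdorff_space_subtopology)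
  define G where "G z = f (SOME x. torus_map x = z)" for z
  have G: "G (torus_map x) = f x" for x
  proof -
    have "torus_map (SOME y. torus_map y = torus_map x) = torus_map x" by (rule someI) simp
    then have "(SOME y. torus_map y = torus_map x) - x \<in> scaled_lattice L" by (simp add: torus_map_eq_iff)
    then have "f (x + ((SOME y. torus_map y = torus_map x) - x)) = f x"
      using per unfolding periodic_def by blast
    then show ?thesis by (simp add: G_def)
  qed
  then have "G \<circ> torus_map = f" by auto
  then have "continuous_map (top_of_set ?B) euclidean (G \<circ> torus_map)"
    using continuous_on_subset[OF cont] by simp
  then have "continuous_map (top_of_set ?S) euclidean G"
    using continuous_compose_quotient_map_eq[OF q] by blast
  then have "continuous_on ?S G" by simp
  moreover have "compact ?S" using cE by (intro compact_continuous_image) auto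
  ultimately obtain g where g: "real_polynomial_function g" "\<And>z. z \<in> ?S \<Longrightarrow> \<bar>G z - g z\<bar> < e"
    using Stone_Weierstrass_real_polynomial_function[of ?S G e] \<open>e > 0\<close> by blast
  show ?thesis
    using polynomial_torus_map_in_span[OF g(1)] g(2) G by (intro bexI[of _ "\<lambda>x. g (torus_map x)"]) force+
qed

lemma ip_span_zero:
  assumes "f \<in> function_space.span S" and "continuous_on UNIV h"
    and "\<And>g. g \<in> S \<Longrightarrow> continuous_on UNIV g" and "\<And>g. g \<in> S \<Longrightarrow> ip g h = 0"
  shows "continuous_on UNIV f \<and> ip f h = 0"
  using assms(1)
proof (induction rule: span_closed_induct)
  case zero
  show ?case by (simp add: ip_def)
next
  case (combine c g k)
  then show ?case using assms(2-4) by (auto simp: ip_combine intro!: continuous_intros)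
qed

lemma ip_self_eq_0:
  assumes "continuous_on UNIV f" "ip f f = 0"
  shows "\<forall>x\<in>cbox 0 L. f x = 0"
proof -
  have "box 0 L \<noteq> {}" using L_pos by (simp add: interval_ne_empty_cart)
  moreover have "continuous_on (cbox 0 L) (\<lambda>x. f x * f x)"
    by (intro continuous_intros continuous_on_subset[OF assms(1)]) simp_all
  ultimately have "\<forall>x\<in>cbox 0 L. f x * f x = 0"
    using assms(2) integral_cbox_eq_0_iff[of 0 L "\<lambda>x. f x * f x"] by (simp add: ip_def)
  then show ?thesis by simp
qed

lemma periodic_eq_0:
  assumes "periodic f" "\<forall>x\<in>cbox 0 L. f x = 0"
  shows "f x = 0"
  using fundamental_box[of x] assms unfolding periodic_def by metis

text \<open>
  Completeness of the trigonometric system: if \<open>p\<close> is a trigonometric polynomial with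
  \<open>\<bar>f - p\<bar> < e\<close>, then \<open>\<langle>f, f\<rangle> = \<langle>f - p, f\<rangle> \<le> e \<integral> \<bar>f\<bar>\<close>.
\<close>

lemma orthogonal_to_trig_eq_0:
  assumes cont: "continuous_on UNIV f" and per: "periodic f"
    and orth: "\<And>g. g \<in> trig frequencies \<Longrightarrow> ip g f = 0"
  shows "f x = 0"
proof -
  define I where "I = integral (cbox 0 L) (\<lambda>x. \<bar>f x\<bar>)"
  have int_abs: "(\<lambda>x. \<bar>f x\<bar>) integrable_on cbox 0 L"
    using cont by (intro integrable_on_box continuous_intros)
  have le: "ip f f \<le> e * I" if e: "e > 0" for e
  proof -
    obtain p where p: "p \<in> function_space.span (trig frequencies)" "\<And>x. x \<in> cbox 0 L \<Longrightarrow> \<bar>f x - p x\<bar> < e"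
      using span_trig_dense[OF cont per e] by blast
    have "continuous_on UNIV p \<and> ip p f = 0"
      using p(1) cont by (rule ip_span_zero) (auto simp: trig_def intro!: continuous_intros orth)
    then have cp: "continuous_on UNIV p" and "ip p f = 0" by auto
    then have "ip f f = integral (cbox 0 L) (\<lambda>x. (f x - p x) * f x)"
      using ip_combine[OF cont cp cont, of "-1"] by (simp add: ip_def)
    also have "\<dots> \<le> integral (cbox 0 L) (\<lambda>x. e * \<bar>f x\<bar>)"
    proof (rule integral_le)
      show "(\<lambda>x. (f x - p x) * f x) integrable_on cbox 0 L" "(\<lambda>x. e * \<bar>f x\<bar>) integrable_on cbox 0 L"
        using cont cp by (intro integrable_on_box continuous_intros; simp)+
      show "(f x - p x) * f x \<le> e * \<bar>f x\<bar>" if "x \<in> cbox 0 L" for x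
      proof -
        have "(f x - p x) * f x \<le> \<bar>f x - p x\<bar> * \<bar>f x\<bar>" by (metis abs_ge_self abs_mult)
        also have "\<dots> \<le> e * \<bar>f x\<bar>" using p(2)[OF that] by (intro mult_right_mono) auto
        finally show ?thesis .
      qed
    qed
    also have "\<dots> = e * I" by (simp add: I_def)
    finally show ?thesis .
  qed
  have "I \<ge> 0" unfolding I_def by (intro integral_nonneg int_abs) auto
  have "ip f f \<le> 0"
  proof (rule field_le_epsilon)
    fix e :: real assume "e > 0"
    have "ip f f \<le> (e / (I + 1)) * I" using \<open>I \<ge> 0\<close> \<open>e > 0\<close> by (intro le) simp
    also have "\<dots> \<le> e" using \<open>I \<ge> 0\<close> \<open>e > 0\<close> by (simp add: field_simps)
    finally show "ip f f \<le> 0 + e" by simp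
  qed
  moreover have "ip f f \<ge> 0"
    unfolding ip_def using cont by (intro integral_nonneg integrable_on_box continuous_intros) auto
  ultimately have "ip f f = 0" by simp
  then show ?thesis using ip_self_eq_0[OF cont] periodic_eq_0[OF per] by blast
qed

text \<open>
  Gram-Schmidt, one generator at a time. The generators may be linearly dependent, since \<open>\<xi>\<close> and
  \<open>-\<xi>\<close> give the same cosine. A new generator may then have the component \<open>b' = 0\<close> orthogonal to the
  previous ones; the coefficient \<open>c\<close> is then \<open>0\<close> by the convention on division by zero, and nothing
  is to be done.
\<close>

lemma orthogonal_projection:
  assumes "finite S" "\<And>g. g \<in> S \<Longrightarrow> continuous_on UNIV g" "continuous_on UNIV f"
  shows "\<exists>v\<in>function_space.span S. \<forall>g\<in>S. ip g (\<lambda>x. f x + (-1) * v x) = 0"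
  using assms
proof (induction S arbitrary: f rule: finite_induct)
  case empty
  then show ?case using function_space.span_zero by blast
next
  case (insert b S)
  note cb = insert.prems(1)[of b, simplified] and cf = insert.prems(2)
  have cS: "continuous_on UNIV g" if "g \<in> S" for g using insert.prems(1) that by simp
  obtain u where u: "u \<in> function_space.span S" "\<And>g. g \<in> S \<Longrightarrow> ip g (\<lambda>x. b x + (-1) * u x) = 0"
    using insert.IH[OF cS cb] by blast
  obtain v where v: "v \<in> function_space.span S" "\<And>g. g \<in> S \<Longrightarrow> ip g (\<lambda>x. f x + (-1) * v x) = 0"
    using insert.IH[OF cS cf] by blast
  define b' where "b' = (\<lambda>x. b x + (-1) * u x)"
  define w where "w = (\<lambda>x. f x + (-1) * v x)"
  have cu: "continuous_on UNIV u" and cv: "continuous_on UNIV v"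
    using ip_span_zero[of _ S "\<lambda>x. 0"] u(1) v(1) cS by (auto simp: ip_def)
  have cb': "continuous_on UNIV b'" and cw: "continuous_on UNIV w"
    unfolding b'_def w_def using cb cu cf cv by (auto intro!: continuous_intros)
  define c where "c = ip b' w / ip b' b'"
  define v' where "v' = (\<lambda>x. v x + c * b' x)"
  have res: "(\<lambda>x. f x + (-1) * v' x) = (\<lambda>x. w x + (- c) * b' x)"
    by (auto simp: v'_def w_def fun_eq_iff algebra_simps)
  have right: "ip g (\<lambda>x. w x + (- c) * b' x) = ip g w - c * ip g b'" if "continuous_on UNIV g" for g
    using ip_combine[OF cw cb' that, of "- c"] by (simp add: ip_commute[of g])
  have S0: "ip g (\<lambda>x. w x + (- c) * b' x) = 0" if "g \<in> S" for g
    using u(2)[OF that, folded b'_def] v(2)[OF that, folded w_def] unfolding right[OF cS[OF that]] by simp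
  have b'0: "ip b' (\<lambda>x. w x + (- c) * b' x) = 0"
  proof (cases "ip b' b' = 0")
    case True
    then have "\<forall>x\<in>cbox 0 L. b' x = 0" by (rule ip_self_eq_0[OF cb'])
    then have "ip b' h = 0" for h
      unfolding ip_def by (intro integral_unique has_integral_is_0_cbox) auto
    then show ?thesis .
  next
    case False
    then show ?thesis unfolding right[OF cb'] by (simp add: c_def)
  qed
  have cres: "continuous_on UNIV (\<lambda>x. w x + (- c) * b' x)" using cw cb' by (intro continuous_intros)
  have u0: "ip u (\<lambda>x. w x + (- c) * b' x) = 0" using ip_span_zero[OF u(1) cres cS S0] by simp
  have "b = (\<lambda>x. b' x + 1 * u x)" by (auto simp: b'_def)
  then have "ip b (\<lambda>x. w x + (- c) * b' x) = 0"
    using ip_combine[OF cb' cu cres, of 1] b'0 u0 by simp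
  then have "\<forall>g\<in>insert b S. ip g (\<lambda>x. f x + (-1) * v' x) = 0"
    unfolding res using S0 by blast
  moreover have "v' \<in> function_space.span (insert b S)"
  proof -
    have mono: "function_space.span S \<subseteq> function_space.span (insert b S)"
      by (rule function_space.span_mono) auto
    have "b \<in> function_space.span (insert b S)" by (rule function_space.span_base) simp
    then have "(\<lambda>x. 1 * b x + (-1) * u x) \<in> function_space.span (insert b S)"
      using u(1) mono by (intro span_combine) auto
    then have "b' \<in> function_space.span (insert b S)" by (simp add: b'_def)
    then have "(\<lambda>x. 1 * v x + c * b' x) \<in> function_space.span (insert b S)"
      using v(1) mono by (intro span_combine) auto
    then show ?thesis by (simp add: v'_def)
  qed
  ultimately show ?case by blast
qed

lemma finite_frequencies: "finite {\<xi> \<in> frequencies. \<xi> \<bullet> \<xi> \<le> C}"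
proof (rule finite_subset)
  show "{\<xi> \<in> frequencies. \<xi> \<bullet> \<xi> \<le> C} \<subseteq> {\<xi> \<in> scaled_lattice (\<chi> i. 2 * pi / L $ i). norm \<xi> \<le> sqrt C}"
    by (auto simp: frequencies_def norm_eq_sqrt_inner)
  show "finite {\<xi> \<in> scaled_lattice (\<chi> i. 2 * pi / L $ i). norm \<xi> \<le> sqrt C}"
    using L_pos by (intro finite_scaled_lattice_bounded) simp
qed

text \<open>
  Subtract from an eigenfunction its projection to the trigonometric functions of the same
  eigenvalue. The rest is orthogonal to these by construction, and to all other trigonometric
  functions because they belong to other eigenvalues. By completeness it vanishes.
\<close>

theorem eigenfunction_in_span_trig:
  assumes f: "smooth_on UNIV f" "periodic f" "\<And>x. flat_laplacian f x = \<mu> * f x"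
  shows "f \<in> function_space.span (trig {\<xi> \<in> frequencies. \<xi> \<bullet> \<xi> = \<mu>})"
proof -
  define \<Xi> where "\<Xi> = {\<xi> \<in> frequencies. \<xi> \<bullet> \<xi> = \<mu>}"
  have fin: "finite (trig \<Xi>)"
    by (intro finite_trig finite_subset[OF _ finite_frequencies[of \<mu>]]) (auto simp: \<Xi>_def)
  have ct: "continuous_on UNIV g" if "g \<in> trig \<Xi>'" for g \<Xi>'
    using that by (auto simp: trig_def intro!: continuous_intros)
  have cf: "continuous_on UNIV f" using f(1) by (rule smooth_on_imp_continuous_on)
  obtain v where v: "v \<in> function_space.span (trig \<Xi>)" "\<And>g. g \<in> trig \<Xi> \<Longrightarrow> ip g (\<lambda>x. f x + (-1) * v x) = 0"
    using orthogonal_projection[OF fin ct[of _ \<Xi>] cf] by blast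
  have cv: "continuous_on UNIV v" using v(1) by (rule continuous_on_span_trig)
  have pv: "periodic v"
    using v(1)
  proof (induction rule: span_closed_induct)
    case zero
    show ?case by (simp add: periodic_def)
  next
    case (combine c g h)
    then have "periodic g" using periodic_trig by (auto simp: trig_def \<Xi>_def)
    then show ?case using combine by (simp add: periodic_def)
  qed
  have trig_eigen: "smooth_on UNIV g \<and> periodic g \<and> (\<forall>x. flat_laplacian g x = (\<xi> \<bullet> \<xi>) * g x)"
    if "\<xi> \<in> frequencies" "g = (\<lambda>x. cos (\<xi> \<bullet> x)) \<or> g = (\<lambda>x. sin (\<xi> \<bullet> x))" for \<xi> g
    using that smooth_on_trig[of UNIV 1 \<xi>] periodic_trig[OF that(1)] flat_laplacian_trig[of \<xi>] by auto
  have "f x + (-1) * v x = 0" for x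
  proof (rule orthogonal_to_trig_eq_0)
    show "continuous_on UNIV (\<lambda>x. f x + (-1) * v x)" using cf cv by (intro continuous_intros)
    show "periodic (\<lambda>x. f x + (-1) * v x)" using f(2) pv by (simp add: periodic_def)
    fix g assume "g \<in> trig frequencies"
    then obtain \<xi> where \<xi>: "\<xi> \<in> frequencies" "g = (\<lambda>x. cos (\<xi> \<bullet> x)) \<or> g = (\<lambda>x. sin (\<xi> \<bullet> x))"
      by (auto simp: trig_def)
    have cg: "continuous_on UNIV g" using \<open>g \<in> trig frequencies\<close> by (rule ct)
    show "ip g (\<lambda>x. f x + (-1) * v x) = 0"
    proof (cases "\<xi> \<bullet> \<xi> = \<mu>")
      case True
      then have "g \<in> trig \<Xi>" using \<xi> by (auto simp: trig_def \<Xi>_def)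
      then show ?thesis by (rule v(2))
    next
      case False
      have fg: "ip f g = 0"
        using f trig_eigen[OF \<xi>] False by (intro ip_eigenfunctions[of f \<mu> g "\<xi> \<bullet> \<xi>"]) auto
      have "ip v g = 0"
      proof (rule conjunct2[OF ip_span_zero[OF v(1) cg ct]])
        fix h assume "h \<in> trig \<Xi>"
        then obtain \<eta> where \<eta>: "\<eta> \<in> frequencies" "\<eta> \<bullet> \<eta> = \<mu>" "h = (\<lambda>x. cos (\<eta> \<bullet> x)) \<or> h = (\<lambda>x. sin (\<eta> \<bullet> x))"
          by (auto simp: trig_def \<Xi>_def)
        then show "ip h g = 0"
          using trig_eigen[OF \<xi>] trig_eigen[OF \<eta>(1,3)] False
          by (intro ip_eigenfunctions[of h \<mu> g "\<xi> \<bullet> \<xi>"]) auto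
      qed
      then show ?thesis
        using ip_combine[OF cf cv cg, of "-1"] fg by (simp add: ip_commute[of g])
    qed
  qed
  then have "f = v" by (auto simp: fun_eq_iff)
  then show ?thesis using v(1) by (simp add: \<Xi>_def)
qed

end

section \<open>Tori and their quotients by reflections of coordinates\<close>

definition reflect :: "'n set \<Rightarrow> real^'n \<Rightarrow> real^'n" where
  "reflect S x = (\<chi> i. if i \<in> S then - x $ i else x $ i)"

lemma reflect_empty [simp]: "reflect {} x = x"
  by (simp add: reflect_def vec_eq_iff)

lemma reflect_add: "reflect S (x + y) = reflect S x + reflect S y"
  by (simp add: reflect_def vec_eq_iff)

lemma reflect_minus: "reflect S (- x) = - reflect S x"
  by (simp add: reflect_def vec_eq_iff)

lemma reflect_0 [simp]: "reflect S 0 = 0"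
  by (simp add: reflect_def vec_eq_iff)

lemma reflect_reflect: "reflect S (reflect T x) = reflect (S - T \<union> (T - S)) x"
  by (auto simp: reflect_def vec_eq_iff)

lemma reflect_involution: "reflect S (reflect S x) = x"
  by (simp add: reflect_reflect)

lemma reflect_lattice:
  assumes "v \<in> scaled_lattice a"
  shows "reflect S v \<in> scaled_lattice a"
  unfolding scaled_lattice_def
proof (intro CollectI allI)
  fix i
  obtain k :: int where "v $ i = of_int k * a $ i"
    using assms unfolding scaled_lattice_def by blast
  then show "\<exists>m::int. reflect S v $ i = of_int m * a $ i"
    by (intro exI[of _ "if i \<in> S then - k else k"]) (simp add: reflect_def)
qed

text \<open>
  A change of an even number of signs preserves the orientation.
\<close>

lemma reflect_rotation_matrix:
  fixes S :: "'n::finite set"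
  assumes "even (card S)"
  shows "\<exists>A. rotation_matrix A \<and> reflect S = (\<lambda>x. A *v x)"
proof -
  define A :: "real^'n^'n" where "A = (\<chi> i j. if i = j then (if i \<in> S then - 1 else 1) else 0)"
  have A: "A *v x = reflect S x" for x
    by (simp add: vec_eq_iff A_def reflect_def matrix_vector_mult_def if_distrib[of "\<lambda>c. c * _"] cong: if_cong)
  have "det A = (\<Prod>i\<in>UNIV. A $ i $ i)" by (rule det_diagonal) (simp add: A_def)
  also have "\<dots> = (\<Prod>i\<in>UNIV. if i \<in> S then - 1 else 1)" by (simp add: A_def)
  also have "\<dots> = (- 1) ^ card S" by (simp add: prod.If_cases)
  finally have det: "det A = 1" using assms by simp
  have "A ** A = mat 1"
    by (simp add: matrix_eq matrix_vector_mul_assoc[symmetric] A reflect_involution)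
  moreover have "transpose A = A" by (auto simp: transpose_def A_def vec_eq_iff)
  ultimately have "rotation_matrix A" using det by (simp add: rotation_matrix_def orthogonal_matrix)
  then show ?thesis using A by (metis ext)
qed

text \<open>
  Each element of \<open>\<S>\<close> is a set of coordinates that change their sign. Closure under symmetric
  differences makes this a group; \<open>\<S> = {{}}\<close> gives the flat torus.
\<close>

definition toral_group :: "real^'n \<Rightarrow> 'n set set \<Rightarrow> (real^'n \<Rightarrow> real^'n) set" where
  "toral_group L \<S> = {\<gamma>. \<exists>S\<in>\<S>. \<exists>v\<in>scaled_lattice L. \<gamma> = (\<lambda>x. reflect S x + v)}"

lemma toral_groupI: "S \<in> \<S> \<Longrightarrow> v \<in> scaled_lattice L \<Longrightarrow> (\<lambda>x. reflect S x + v) \<in> toral_group L \<S>"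
  by (auto simp: toral_group_def)

context period_box
begin

lemma rotation_group_toral_group:
  assumes empty: "{} \<in> \<S>" and symdiff: "\<And>S T. S \<in> \<S> \<Longrightarrow> T \<in> \<S> \<Longrightarrow> S - T \<union> (T - S) \<in> \<S>"
    and even: "\<And>S. S \<in> \<S> \<Longrightarrow> even (card S)"
  shows "rotation_group (toral_group L \<S>)"
proof
  show "id \<in> toral_group L \<S>"
    using toral_groupI[OF empty scaled_lattice_0] by (simp add: id_def)
next
  fix \<gamma> \<delta> assume "\<gamma> \<in> toral_group L \<S>" "\<delta> \<in> toral_group L \<S>"
  then obtain S T v u where S: "S \<in> \<S>" "v \<in> scaled_lattice L" "\<gamma> = (\<lambda>x. reflect S x + v)"
    and T: "T \<in> \<S>" "u \<in> scaled_lattice L" "\<delta> = (\<lambda>x. reflect T x + u)"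
    by (auto simp: toral_group_def)
  have "\<gamma> \<circ> \<delta> = (\<lambda>x. reflect (S - T \<union> (T - S)) x + (reflect S u + v))"
    by (simp add: S(3) T(3) fun_eq_iff reflect_add reflect_reflect add.assoc)
  then show "\<gamma> \<circ> \<delta> \<in> toral_group L \<S>"
    by (simp only:) (intro toral_groupI symdiff scaled_lattice_add reflect_lattice S T)
next
  fix \<gamma> assume "\<gamma> \<in> toral_group L \<S>"
  then obtain S v where S: "S \<in> \<S>" "v \<in> scaled_lattice L" "\<gamma> = (\<lambda>x. reflect S x + v)"
    by (auto simp: toral_group_def)
  define \<delta> where "\<delta> = (\<lambda>x. reflect S x + - reflect S v)"
  have "\<delta> \<in> toral_group L \<S>"
    unfolding \<delta>_def by (intro toral_groupI scaled_lattice_minus reflect_lattice S)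
  moreover have "\<delta> \<circ> \<gamma> = id" "\<gamma> \<circ> \<delta> = id"
    by (simp_all add: S(3) \<delta>_def fun_eq_iff reflect_add reflect_minus reflect_involution
        del: add_uminus_conv_diff)
  ultimately show "\<exists>\<delta>\<in>toral_group L \<S>. \<delta> \<circ> \<gamma> = id \<and> \<gamma> \<circ> \<delta> = id" by blast
next
  fix \<gamma> assume "\<gamma> \<in> toral_group L \<S>"
  then obtain S v where S: "S \<in> \<S>" "\<gamma> = (\<lambda>x. reflect S x + v)" by (auto simp: toral_group_def)
  obtain A where "rotation_matrix A" "reflect S = (\<lambda>x. A *v x)"
    using reflect_rotation_matrix even[OF S(1)] by blast
  then show "\<exists>A b. \<gamma> = (\<lambda>x. A *v x + b) \<and> rotation_matrix A" using S(2) by auto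
next
  fix R
  have "{\<gamma> \<in> toral_group L \<S>. norm (\<gamma> 0) \<le> R} \<subseteq>
      (\<lambda>(S, v) x. reflect S x + v) ` (UNIV \<times> {v \<in> scaled_lattice L. norm v \<le> R})"
    by (auto simp: toral_group_def)
  moreover have "finite {v \<in> scaled_lattice L. norm v \<le> R}"
    using L_pos by (rule finite_scaled_lattice_bounded)
  ultimately show "finite {\<gamma> \<in> toral_group L \<S>. norm (\<gamma> 0) \<le> R}"
    by (auto intro: finite_subset)
next
  have "\<exists>\<gamma>\<in>toral_group L \<S>. \<gamma> x \<in> cbox 0 L" for x
    using fundamental_box[of x] toral_groupI[OF empty] by fastforce
  then show "\<exists>K. compact K \<and> (\<forall>x. \<exists>\<gamma>\<in>toral_group L \<S>. \<gamma> x \<in> K)"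
    by (intro exI[of _ "cbox 0 L"]) (simp add: compact_cbox)
qed

lemma toral_group_translations_free:
  assumes "\<gamma> \<in> toral_group L {{}}" "\<gamma> x = x"
  shows "\<gamma> = id"
  using assms by (auto simp: toral_group_def)

lemma invariant_iff_periodic:
  assumes "{} \<in> \<S>"
  shows "(\<forall>\<gamma>\<in>toral_group L \<S>. \<forall>x. f (\<gamma> x) = f x) \<longleftrightarrow> periodic f \<and> (\<forall>S\<in>\<S>. \<forall>x. f (reflect S x) = f x)"
proof (intro iffI conjI)
  assume inv: "\<forall>\<gamma>\<in>toral_group L \<S>. \<forall>x. f (\<gamma> x) = f x"
  show "periodic f" using inv toral_groupI[OF assms] by (fastforce simp: periodic_def)
  show "\<forall>S\<in>\<S>. \<forall>x. f (reflect S x) = f x"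
    using inv toral_groupI[OF _ scaled_lattice_0] by fastforce
next
  assume "periodic f \<and> (\<forall>S\<in>\<S>. \<forall>x. f (reflect S x) = f x)"
  then show "\<forall>\<gamma>\<in>toral_group L \<S>. \<forall>x. f (\<gamma> x) = f x"
    by (auto simp: toral_group_def periodic_def)
qed

definition periodic_eigenfunctions :: "real \<Rightarrow> (real^'n \<Rightarrow> real) set" where
  "periodic_eigenfunctions \<mu> = {f. periodic f \<and> smooth_on UNIV f \<and> (\<forall>x. flat_laplacian f x = \<mu> * f x)}"

lemma periodic_eigenfunctions_span:
  "periodic_eigenfunctions \<mu> \<subseteq> function_space.span (trig {\<xi> \<in> frequencies. \<xi> \<bullet> \<xi> = \<mu>})"
  using eigenfunction_in_span_trig by (auto simp: periodic_eigenfunctions_def)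

lemma invariant_eigenfunctions_toral_group:
  assumes "rotation_group (toral_group L \<S>)" "{} \<in> \<S>"
  shows "rotation_group.invariant_eigenfunctions (toral_group L \<S>) \<mu> =
    {f \<in> periodic_eigenfunctions \<mu>. \<forall>S\<in>\<S>. \<forall>x. f (reflect S x) = f x}"
  unfolding rotation_group.invariant_eigenfunctions_def[OF assms(1)] invariant_iff_periodic[OF assms(2)]
  by (auto simp: periodic_eigenfunctions_def)

end

section \<open>Equal eigenvalues of a thin torus and its quotient\<close>

text \<open>
  The bound by a finite set matters: the dimension of an infinite-dimensional space is \<open>0\<close> as well.
\<close>

lemma dim_function_space_eq_0_iff:
  fixes E :: "('a \<Rightarrow> real) set"
  assumes "E \<subseteq> function_space.span W" "finite W"
  shows "function_space.dim E = 0 \<longleftrightarrow> E \<subseteq> {0}"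
proof
  assume dim: "function_space.dim E = 0"
  obtain B where B: "B \<subseteq> E" "function_space.independent B" "E \<subseteq> function_space.span B"
      "card B = function_space.dim E"
    using function_space.basis_exists by blast
  have "finite B" using function_space.independent_span_bound[OF assms(2) B(2)] B(1) assms(1) by blast
  then have "B = {}" using B(4) dim by simp
  then show "E \<subseteq> {0}" using B(3) by simp
next
  assume "E \<subseteq> {0}"
  then have "E \<subseteq> function_space.span {}" by simp
  then show "function_space.dim E = 0" using function_space.dim_le_card[of E "{}"] by simp
qed

theorem theorem8p2:
  fixes N m :: nat
  assumes "N > 0" and "m \<ge> 2" and "CARD('n::finite) = 2 * m"
  shows "\<exists>(Orb :: nat \<Rightarrow> ((real^'n) set, 'n) riem_orbifold) (M :: ((real^'n) set, 'n) riem_orbifold).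
           (\<forall>l\<ge>1. closed_oriented_riemannian_orbifold (Orb l) \<and> singular_points (Orb l) \<noteq> {}) \<and>
           closed_oriented_riemannian_manifold M \<and>
           (\<forall>l\<ge>1. \<forall>k\<le>N. \<bar>laplace_eigenvalue (Orb l) k - laplace_eigenvalue M k\<bar> < 1 / real l)"
proof -
  have "3 \<le> CARD('n)" using assms by simp
  then obtain I :: "'n set" where "card I = 3" by (metis obtain_subset_with_card_n)
  then obtain a b c :: 'n where abc: "a \<noteq> b" "b \<noteq> c" "a \<noteq> c" by (metis card_3_iff)
  \<comment> \<open>In direction \<open>c\<close> the frequencies are the integers, in all others the multiples of \<open>N + 1\<close>.\<close>
  define L :: "real^'n" where "L = (\<chi> i. if i = c then 2 * pi else 2 * pi / (real N + 1))"
  interpret period_box L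
    by unfold_locales (auto simp: L_def intro!: divide_pos_pos add_nonneg_pos)
  define T where "T = toral_group L {{}}"
  define G where "G = toral_group L {{}, {a, b}}"
  have T: "rotation_group T" unfolding T_def by (intro rotation_group_toral_group) auto
  have G: "rotation_group G" unfolding G_def using abc by (intro rotation_group_toral_group) auto
  define M where "M = quotient_orbifold T"
  define P where "P = quotient_orbifold G"
  have M: "closed_oriented_riemannian_manifold M"
    unfolding M_def using toral_group_translations_free
    by (intro rotation_group.closed_oriented_riemannian_manifold_quotient_orbifold[OF T]) (auto simp: T_def)
  have P: "closed_oriented_riemannian_orbifold P"
    unfolding P_def by (rule rotation_group.closed_oriented_riemannian_orbifold_quotient_orbifold[OF G])
  have sing: "singular_points P \<noteq> {}"
  proof -
    have "reflect {a, b} \<in> G"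
      using toral_groupI[of "{a, b}" "{{}, {a, b}}" 0 L] by (simp add: G_def scaled_lattice_0)
    moreover have "reflect {a, b} (axis a 1) $ a \<noteq> (axis a 1 :: real^'n) $ a" by (simp add: reflect_def)
    then have "reflect {a, b} \<noteq> id" by auto
    ultimately show ?thesis
      unfolding P_def using rotation_group.singular_point_quotient_orbifold[OF G, of "reflect {a, b}" 0]
      by auto
  qed
  define dT where "dT \<mu> = function_space.dim (laplace_eigenspace M \<mu>)" for \<mu>
  define dG where "dG \<mu> = function_space.dim (laplace_eigenspace P \<mu>)" for \<mu>
  define E where "E \<mu> = {f \<in> periodic_eigenfunctions \<mu>. \<forall>x. f (reflect {a, b} x) = f x}" for \<mu>
  have dT: "dT \<mu> = function_space.dim (periodic_eigenfunctions \<mu>)" for \<mu>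
    using rotation_group.dim_laplace_eigenspace[OF T] invariant_eigenfunctions_toral_group[of "{{}}"] T
    by (simp add: dT_def M_def T_def)
  have dG: "dG \<mu> = function_space.dim (E \<mu>)" for \<mu>
    using rotation_group.dim_laplace_eigenspace[OF G] invariant_eigenfunctions_toral_group[of "{{}, {a, b}}"] G
    by (simp add: dG_def P_def G_def E_def)
  have fin_trig: "finite (trig {\<xi> \<in> frequencies. \<xi> \<bullet> \<xi> = \<mu>})" for \<mu>
    by (intro finite_trig finite_subset[OF _ finite_frequencies[of \<mu>]]) auto
  have dT0: "dT \<mu> = 0 \<longleftrightarrow> periodic_eigenfunctions \<mu> \<subseteq> {0}" for \<mu>
    unfolding dT by (rule dim_function_space_eq_0_iff[OF periodic_eigenfunctions_span fin_trig])
  have dG0: "dG \<mu> = 0 \<longleftrightarrow> E \<mu> \<subseteq> {0}" for \<mu>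
    unfolding dG
    by (rule dim_function_space_eq_0_iff[OF order_trans[OF _ periodic_eigenfunctions_span] fin_trig])
      (auto simp: E_def)
  have freq: "\<xi> \<in> frequencies \<longleftrightarrow> (\<forall>i. \<exists>n::int. \<xi> $ i = of_int n * (if i = c then 1 else real N + 1))" for \<xi>
    unfolding frequencies_def scaled_lattice_def by (simp add: L_def if_distrib cong: if_cong)
  \<comment> \<open>Below \<open>(N + 1)\<^sup>2\<close> all frequencies point in direction \<open>c\<close>, which the half-turn does not move.\<close>
  have low: "E \<mu> = periodic_eigenfunctions \<mu>" if "\<mu> < (real N + 1)\<^sup>2" for \<mu>
  proof -
    have "f (reflect {a, b} x) = f x" if "f \<in> periodic_eigenfunctions \<mu>" for f x
    proof -
      have inner: "\<xi> \<bullet> reflect {a, b} x = \<xi> \<bullet> x" if "\<xi> \<in> frequencies" "\<xi> \<bullet> \<xi> = \<mu>" for \<xi>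
      proof -
        have "\<xi> $ i = 0" if "i \<noteq> c" for i
        proof (rule ccontr)
          assume "\<xi> $ i \<noteq> 0"
          obtain n :: int where n: "\<xi> $ i = of_int n * (real N + 1)"
            using \<open>\<xi> \<in> frequencies\<close> \<open>i \<noteq> c\<close> unfolding freq by metis
          then have "n \<noteq> 0" using \<open>\<xi> $ i \<noteq> 0\<close> by auto
          then have "1 \<le> \<bar>real_of_int n\<bar>" by linarith
          then have "1 * (real N + 1) \<le> \<bar>real_of_int n\<bar> * (real N + 1)" by (intro mult_right_mono) auto
          also have "\<dots> = \<bar>\<xi> $ i\<bar>" by (simp add: n abs_mult)
          finally have "(real N + 1)\<^sup>2 \<le> (\<xi> $ i)\<^sup>2" by (metis abs_le_square_iff abs_of_nonneg add_nonneg_nonneg mult_1 of_nat_0_le_iff zero_le_one)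
          also have "\<dots> \<le> (norm \<xi>)\<^sup>2" using component_le_norm_cart[of \<xi> i] by (metis abs_ge_zero power2_abs power_mono)
          also have "\<dots> = \<mu>" using \<open>\<xi> \<bullet> \<xi> = \<mu>\<close> by (simp add: power2_norm_eq_inner)
          finally show False using \<open>\<mu> < (real N + 1)\<^sup>2\<close> by simp
        qed
        then have "\<xi> $ i * reflect {a, b} x $ i = \<xi> $ i * x $ i" for i
          using abc by (cases "i = c") (auto simp: reflect_def)
        then show ?thesis by (simp only: inner_vec_def inner_real_def)
      qed
      have "f \<in> function_space.span (trig {\<xi> \<in> frequencies. \<xi> \<bullet> \<xi> = \<mu>})"
        using that periodic_eigenfunctions_span by blast
      then show ?thesis
      proof (induction rule: span_closed_induct)
        case (combine r g h)
        then show ?case using inner by (auto simp: trig_def)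
      qed simp
    qed
    then show ?thesis by (auto simp: E_def)
  qed
  \<comment> \<open>The squares are eigenvalues of both spaces because of the functions \<open>cos (n x\<^sub>c)\<close>.\<close>
  have square: "dG ((real n)\<^sup>2) \<noteq> 0" "dT ((real n)\<^sup>2) \<noteq> 0" for n :: nat
  proof -
    define \<xi> :: "real^'n" where "\<xi> = axis c (real n)"
    have "\<xi> \<in> frequencies"
      unfolding freq \<xi>_def by (auto simp: axis_def intro: exI[of _ "int n"] exI[of _ 0])
    moreover have "\<xi> \<bullet> \<xi> = (real n)\<^sup>2" by (simp add: \<xi>_def inner_axis power2_eq_square)
    moreover have "\<xi> \<bullet> reflect {a, b} x = \<xi> \<bullet> x" for x
      using abc by (simp add: \<xi>_def inner_axis' reflect_def)
    ultimately have "(\<lambda>x. cos (\<xi> \<bullet> x)) \<in> E ((real n)\<^sup>2)"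
      using smooth_on_trig(1)[of UNIV 1 \<xi>] periodic_trig(1) flat_laplacian_trig(1)[of \<xi>]
      by (simp add: E_def periodic_eigenfunctions_def)
    moreover have "(\<lambda>x. cos (\<xi> \<bullet> x)) \<noteq> 0"
      by (metis cos_zero inner_zero_right zero_fun_def zero_neq_one)
    ultimately show "dG ((real n)\<^sup>2) \<noteq> 0" "dT ((real n)\<^sup>2) \<noteq> 0"
      unfolding dG0 dT0 by (auto simp: E_def)
  qed
  have finT: "finite ({\<mu>. \<mu> \<noteq> 0 \<and> dT \<mu> \<noteq> 0} \<inter> {..C})" for C
  proof (rule finite_subset)
    show "finite ((\<lambda>\<xi>. \<xi> \<bullet> \<xi>) ` {\<xi> \<in> frequencies. \<xi> \<bullet> \<xi> \<le> C})"
      by (intro finite_imageI finite_frequencies)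
    show "{\<mu>. \<mu> \<noteq> 0 \<and> dT \<mu> \<noteq> 0} \<inter> {..C} \<subseteq> (\<lambda>\<xi>. \<xi> \<bullet> \<xi>) ` {\<xi> \<in> frequencies. \<xi> \<bullet> \<xi> \<le> C}"
    proof
      fix \<mu> assume \<mu>: "\<mu> \<in> {\<mu>. \<mu> \<noteq> 0 \<and> dT \<mu> \<noteq> 0} \<inter> {..C}"
      then have "trig {\<xi> \<in> frequencies. \<xi> \<bullet> \<xi> = \<mu>} \<noteq> {}"
        using periodic_eigenfunctions_span[of \<mu>] by (auto simp: dT0)
      then show "\<mu> \<in> (\<lambda>\<xi>. \<xi> \<bullet> \<xi>) ` {\<xi> \<in> frequencies. \<xi> \<bullet> \<xi> \<le> C}"
        using \<mu> by (auto simp: trig_def)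
    qed
  qed
  have finG: "finite ({\<mu>. \<mu> \<noteq> 0 \<and> dG \<mu> \<noteq> 0} \<inter> {..C})" for C
    by (rule finite_subset[OF _ finT[of C]]) (auto simp: dG0 dT0 E_def)
  have inj: "inj_on (\<lambda>n. (real n)\<^sup>2) A" for A by (auto intro!: inj_onI)
  have inf: "infinite {\<mu>. \<mu> \<noteq> 0 \<and> dT \<mu> \<noteq> 0}" "infinite {\<mu>. \<mu> \<noteq> 0 \<and> dG \<mu> \<noteq> 0}"
  proof -
    have "infinite ((\<lambda>n. (real n)\<^sup>2) ` {1..})" using finite_imageD[OF _ inj] infinite_Ici by blast
    then show "infinite {\<mu>. \<mu> \<noteq> 0 \<and> dT \<mu> \<noteq> 0}" "infinite {\<mu>. \<mu> \<noteq> 0 \<and> dG \<mu> \<noteq> 0}"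
      by (rule infinite_super[rotated]; use square in auto)+
  qed
  have count: "N \<le> card ({\<mu>. \<mu> \<noteq> 0 \<and> dG \<mu> \<noteq> 0} \<inter> {..<(real N + 1)\<^sup>2})"
  proof -
    have "N = card ((\<lambda>n. (real n)\<^sup>2) ` {1..N})" by (simp add: card_image[OF inj])
    also have "\<dots> \<le> card ({\<mu>. \<mu> \<noteq> 0 \<and> dG \<mu> \<noteq> 0} \<inter> {..<(real N + 1)\<^sup>2})"
    proof (rule card_mono)
      show "finite ({\<mu>. \<mu> \<noteq> 0 \<and> dG \<mu> \<noteq> 0} \<inter> {..<(real N + 1)\<^sup>2})"
        by (rule finite_subset[OF _ finG[of "(real N + 1)\<^sup>2"]]) auto
      show "(\<lambda>n. (real n)\<^sup>2) ` {1..N} \<subseteq> {\<mu>. \<mu> \<noteq> 0 \<and> dG \<mu> \<noteq> 0} \<inter> {..<(real N + 1)\<^sup>2}"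
        using square by (auto intro!: power_strict_mono)
    qed
    finally show ?thesis .
  qed
  have "laplace_eigenvalue P k = laplace_eigenvalue M k" if "k \<le> N" for k
  proof (rule laplace_eigenvalue_cong_below[OF _ _ _ _ _ _ that])
    show "function_space.dim (laplace_eigenspace P \<mu>) = function_space.dim (laplace_eigenspace M \<mu>)"
      if "\<mu> < (real N + 1)\<^sup>2" for \<mu>
      using dT[of \<mu>] dG[of \<mu>] low[OF that] by (simp add: dT_def dG_def)
  qed (use finT finG inf count in \<open>simp_all add: dT_def dG_def\<close>)
  \<comment> \<open>The eigenvalues with index at most \<open>N\<close> coincide, so a constant sequence converges.\<close>
  then show ?thesis
    using P M sing by (intro exI[of _ "\<lambda>_. P"] exI[of _ M]) simp
qed

end
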